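(* Let $G^\bullet$ be a Gerstenhaber algebra over a field $k$ of characteristic $0$, and let $\Omega^n(G^\bullet)^\sim$ and $\Omega^n(G^\bullet)$ ($n\ge 0$) be the spaces defined in the context. Then the differential $d$ defined in the context maps $\Omega^n(G^\bullet)^\sim$ into $\Omega^{n+1}(G^\bullet)^\sim$ for all $n\ge 0$ and satisfies $d\circ d=0$, so that $(\Omega^\bullet(G^\bullet)^\sim,d)$ is a complex (the big de Rham complex of $G^\bullet$). Moreover $d$ maps $\Omega^n(G^\bullet)$ into $\Omega^{n+1}(G^\bullet)$ for all $n\ge 0$, so that $\Omega^\bullet(G^\bullet)$ is a subcomplex (the small de Rham complex of $G^\bullet$).
   Context: For a homogeneous element $x\in G^i$ write $\tilde x=i$. A Gerstenhaber algebra is a $\mathbb{Z}$-graded, associative, graded-commutative $k$-algebra $G^\bullet$ ($xy=(-1)^{\tilde x\tilde y}yx$) with a bilinear bracket $[\,,]:G^i\otimes G^j\to G^{i+j-1}$ such that for homogeneous $x,y,z$: (G1) $[x,y]=-(-1)^{(\tilde x-1)(\tilde y-1)}[y,x]$; (G2) $[x,[y,z]]=[[x,y],z]+(-1)^{(\tilde x-1)(\tilde y-1)}[y,[x,z]]$; (G3) $[x,yz]=[x,y]z+(-1)^{\tilde y(\tilde x-1)}y[x,z]$. A multilinear map $f:(G^\bullet)^n\to G^\bullet$ is homogeneous of degree $\tilde f$ if $f(x_1,\dots,x_n)$ is homogeneous of degree $\tilde f+\sum_j\tilde x_j$ for homogeneous $x_j$. All formulas are for homogeneous elements and homogeneous maps,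 and are extended by linearity. Set $\Omega^0(G^\bullet)^\sim=G^\bullet$. For $n\ge1$, $\Omega^n(G^\bullet)^\sim$ is the space of $k$-multilinear maps $f:(G^\bullet)^n\to G^\bullet$ (spanned by homogeneous ones) such that (a) $f(x_1,\dots,x_i,x_{i+1},\dots,x_n)=-(-1)^{(\tilde x_i-1)(\tilde x_{i+1}-1)}f(x_1,\dots,x_{i+1},x_i,\dots,x_n)$ for $1\le i\le n-1$; (b) $f(x_1,\dots,x_{n-1},yz)=(-1)^{\tilde y(\tilde f+\sum_{p=1}^{n-1}\tilde x_p)}\,y\,f(x_1,\dots,x_{n-1},z)+f(x_1,\dots,x_{n-1},y)\,z$. Set $\Omega^0(G^\bullet)=G^0$ and, for $n\ge1$, $\Omega^n(G^\bullet)=\{f\in\Omega^n(G^\bullet)^\sim:\tilde f=-n\}$. The differential $d$: for $g\in\Omega^0(G^\bullet)^\sim=G^\bullet$, $dg(x)=[g,x]$. For $n\ge1$ and $f\in\Omega^n(G^\bullet)^\sim$, $$df(x_1,\dots,x_{n+1})=\sum_{i=1}^{n+1}(-1)^{i+1+(\tilde x_i-1)\left(\tilde f+n-1+\sum_{p=1}^{i-1}(\tilde x_p-1)\right)}[x_i,f(x_1,\dots,\hat x_i,\dots,x_{n+1})]$$ $$+\sum_{1\le i<j\le n+1}(-1)^{i+j+(\tilde x_i-1)\sum_{p=1}^{i-1}(\tilde x_p-1)+(\tilde x_j-1)\sum_{1\le q\le j-1,\,q\ne i}(\tilde x_q-1)}f([x_i,x_j],x_1,\dots,\hat x_i,\dots,\hat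 x_j,\dots,x_{n+1}),$$ where hats denote omitted arguments. *)

theory Defs
  imports Complex_Main "HOL-Library.Function_Algebras"
begin

section \<open>Internal direct sums\<close>

definition is_decomposition :: "('i \<Rightarrow> 'b::comm_monoid_add set) \<Rightarrow> 'b \<Rightarrow> ('i \<Rightarrow> 'b) \<Rightarrow> bool" where
  "is_decomposition A x c \<longleftrightarrow>
     (\<forall>i. c i \<in> A i) \<and> finite {i. c i \<noteq> 0} \<and> x = (\<Sum>i\<in>{i. c i \<noteq> 0}. c i)"

definition component :: "('i \<Rightarrow> 'b::comm_monoid_add set) \<Rightarrow> 'b \<Rightarrow> 'i \<Rightarrow> 'b" where
  "component A x = (THE c. is_decomposition A x c)"

section \<open>Gerstenhaber algebras\<close>

text \<open>The underlying associative ring is the whole type; no unit element is required.\<close>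

locale gerstenhaber_algebra = vector_space scale
  for scale :: "'k::field \<Rightarrow> 'a::ring \<Rightarrow> 'a" +
  fixes gr :: "int \<Rightarrow> 'a set"
    and br :: "'a \<Rightarrow> 'a \<Rightarrow> 'a"
  assumes scale_mult_left: "scale c (x * y) = scale c x * y"
    and scale_mult_right: "scale c (x * y) = x * scale c y"
    and subspace_gr: "subspace (gr i)"
    and direct_sum_gr: "\<exists>!c. is_decomposition gr x c"
    and mult_gr: "x \<in> gr i \<Longrightarrow> y \<in> gr j \<Longrightarrow> x * y \<in> gr (i + j)"
    and graded_commute: "x \<in> gr i \<Longrightarrow> y \<in> gr j \<Longrightarrow> x * y = scale ((-1) powi (i * j)) (y * x)"
    and linear_br_left: "Vector_Spaces.linear scale scale (\<lambda>x. br x y)"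
    and linear_br_right: "Vector_Spaces.linear scale scale (\<lambda>y. br x y)"
    and br_gr: "x \<in> gr i \<Longrightarrow> y \<in> gr j \<Longrightarrow> br x y \<in> gr (i + j - 1)"
    and br_antisym: "x \<in> gr i \<Longrightarrow> y \<in> gr j \<Longrightarrow>
          br x y = - scale ((-1) powi ((i - 1) * (j - 1))) (br y x)"
    and br_jacobi: "x \<in> gr i \<Longrightarrow> y \<in> gr j \<Longrightarrow> z \<in> gr l \<Longrightarrow>
          br x (br y z) = br (br x y) z + scale ((-1) powi ((i - 1) * (j - 1))) (br y (br x z))"
    and br_leibniz: "x \<in> gr i \<Longrightarrow> y \<in> gr j \<Longrightarrow> z \<in> gr l \<Longrightarrow>
          br x (y * z) = br x y * z + scale ((-1) powi (j * (i - 1))) (y * br x z)"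

section \<open>Multilinear maps\<close>

text \<open>
  An \<open>n\<close>-ary map is a function on lists that vanishes on all lists of length other than \<open>n\<close>, so
  that equality of \<open>n\<close>-ary maps is equality of functions.  Addition is pointwise (from
  \<^theory>\<open>HOL-Library.Function_Algebras\<close>).
\<close>

definition map_scale :: "('k \<Rightarrow> 'a \<Rightarrow> 'a) \<Rightarrow> 'k \<Rightarrow> ('a list \<Rightarrow> 'a) \<Rightarrow> 'a list \<Rightarrow> 'a" where
  "map_scale scale c f = (\<lambda>xs. scale c (f xs))"

definition multilinear :: "('k::field \<Rightarrow> 'a::ring \<Rightarrow> 'a) \<Rightarrow> nat \<Rightarrow> ('a list \<Rightarrow> 'a) \<Rightarrow> bool" where
  "multilinear scale n f \<longleftrightarrow>
     (\<forall>xs. length xs \<noteq> n \<longrightarrow> f xs = 0) \<and>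
     (\<forall>xs i. length xs = n \<longrightarrow> i < n \<longrightarrow> Vector_Spaces.linear scale scale (\<lambda>x. f (xs[i := x])))"

definition homogeneous_list :: "(int \<Rightarrow> 'a set) \<Rightarrow> 'a list \<Rightarrow> int list \<Rightarrow> bool" where
  "homogeneous_list gr xs ds \<longleftrightarrow> list_all2 (\<lambda>x i. x \<in> gr i) xs ds"

definition homogeneous_map :: "(int \<Rightarrow> 'a set) \<Rightarrow> nat \<Rightarrow> int \<Rightarrow> ('a list \<Rightarrow> 'a) \<Rightarrow> bool" where
  "homogeneous_map gr n m f \<longleftrightarrow>
     (\<forall>xs ds. length xs = n \<longrightarrow> homogeneous_list gr xs ds \<longrightarrow> f xs \<in> gr (m + sum_list ds))"

text \<open>
  The multilinear extension of an expression \<open>F ds xs\<close> that is only meaningful for homogeneous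
  arguments \<open>xs\<close> of degrees \<open>ds\<close>: each argument is split into its homogeneous components.
\<close>

definition multilinear_extension ::
    "(int \<Rightarrow> 'a::ring set) \<Rightarrow> nat \<Rightarrow> (int list \<Rightarrow> 'a list \<Rightarrow> 'a) \<Rightarrow> 'a list \<Rightarrow> 'a" where
  "multilinear_extension gr n F xs =
     (if length xs = n
      then \<Sum>ds\<in>listset (map (\<lambda>x. {i. component gr x i \<noteq> 0}) xs). F ds (map2 (component gr) xs ds)
      else 0)"

section \<open>The spaces of forms\<close>

definition graded_antisymmetric ::
    "('k::field \<Rightarrow> 'a::ring \<Rightarrow> 'a) \<Rightarrow> (int \<Rightarrow> 'a set) \<Rightarrow> nat \<Rightarrow> ('a list \<Rightarrow> 'a) \<Rightarrow> bool" where
  "graded_antisymmetric scale gr n f \<longleftrightarrow>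
     (\<forall>xs ds i. length xs = n \<longrightarrow> homogeneous_list gr xs ds \<longrightarrow> Suc i < n \<longrightarrow>
        f xs = - scale ((-1) powi ((ds ! i - 1) * (ds ! Suc i - 1)))
                   (f (xs[i := xs ! Suc i, Suc i := xs ! i])))"

definition derivation_last ::
    "('k::field \<Rightarrow> 'a::ring \<Rightarrow> 'a) \<Rightarrow> (int \<Rightarrow> 'a set) \<Rightarrow> nat \<Rightarrow> int \<Rightarrow> ('a list \<Rightarrow> 'a) \<Rightarrow> bool" where
  "derivation_last scale gr n m f \<longleftrightarrow>
     (\<forall>xs ds y j z l. length xs = n - 1 \<longrightarrow> homogeneous_list gr xs ds \<longrightarrow> y \<in> gr j \<longrightarrow> z \<in> gr l \<longrightarrow>
        f (xs @ [y * z]) =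
          scale ((-1) powi (j * (m + sum_list ds))) (y * f (xs @ [z])) + f (xs @ [y]) * z)"

text \<open>The homogeneous elements of degree \<open>m\<close> in the big space of \<open>n\<close>-forms, for \<open>n \<ge> 1\<close>.\<close>

definition hom_forms ::
    "('k::field \<Rightarrow> 'a::ring \<Rightarrow> 'a) \<Rightarrow> (int \<Rightarrow> 'a set) \<Rightarrow> nat \<Rightarrow> int \<Rightarrow> ('a list \<Rightarrow> 'a) set" where
  "hom_forms scale gr n m =
     {f. multilinear scale n f \<and> homogeneous_map gr n m f \<and>
         graded_antisymmetric scale gr n f \<and> derivation_last scale gr n m f}"

text \<open>An element of the algebra, viewed as a map with no arguments.\<close>

definition const_form :: "'a \<Rightarrow> 'a::ring list \<Rightarrow> 'a" where
  "const_form g = (\<lambda>xs. if xs = [] then g else 0)"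

definition big_forms ::
    "('k::field \<Rightarrow> 'a::ring \<Rightarrow> 'a) \<Rightarrow> (int \<Rightarrow> 'a set) \<Rightarrow> nat \<Rightarrow> ('a list \<Rightarrow> 'a) set" where
  "big_forms scale gr n =
     (if n = 0 then range const_form
      else module.span (map_scale scale) (\<Union>m. hom_forms scale gr n m))"

definition small_forms ::
    "('k::field \<Rightarrow> 'a::ring \<Rightarrow> 'a) \<Rightarrow> (int \<Rightarrow> 'a set) \<Rightarrow> nat \<Rightarrow> ('a list \<Rightarrow> 'a) set" where
  "small_forms scale gr n =
     (if n = 0 then const_form ` gr 0
      else {f \<in> big_forms scale gr n. homogeneous_map gr n (- int n) f})"

section \<open>The differential\<close>

text \<open>
  The value of the differential of an \<open>n\<close>-form \<open>f\<close> of degree \<open>m\<close> (\<open>n \<ge> 1\<close>) on homogeneous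
  arguments \<open>xs\<close> of degrees \<open>ds\<close>.  Positions are counted from 0 here and from 1 in the usual
  formula; this does not change the parities of \<open>i + 1 + \<dots>\<close> (which becomes \<open>i + \<dots>\<close>) and
  \<open>i + j + \<dots>\<close>.
\<close>

definition diff_hom ::
    "('k::field \<Rightarrow> 'a::ring \<Rightarrow> 'a) \<Rightarrow> ('a \<Rightarrow> 'a \<Rightarrow> 'a) \<Rightarrow> nat \<Rightarrow> int \<Rightarrow> ('a list \<Rightarrow> 'a) \<Rightarrow>
      int list \<Rightarrow> 'a list \<Rightarrow> 'a" where
  "diff_hom scale br n m f ds xs =
     (\<Sum>i\<le>n. scale
        ((-1) powi (int i + (ds ! i - 1) * (m + int n - 1 + (\<Sum>p<i. (ds ! p - 1)))))
        (br (xs ! i) (f (nths xs (- {i}))))) +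
     (\<Sum>j\<le>n. \<Sum>i<j. scale
        ((-1) powi (int i + int j + (ds ! i - 1) * (\<Sum>p<i. (ds ! p - 1))
                     + (ds ! j - 1) * (\<Sum>q\<in>{..<j} - {i}. (ds ! q - 1))))
        (f (br (xs ! i) (xs ! j) # nths xs (- {i, j}))))"

definition diff ::
    "('k::field \<Rightarrow> 'a::ring \<Rightarrow> 'a) \<Rightarrow> (int \<Rightarrow> 'a set) \<Rightarrow> ('a \<Rightarrow> 'a \<Rightarrow> 'a) \<Rightarrow> nat \<Rightarrow>
      ('a list \<Rightarrow> 'a) \<Rightarrow> 'a list \<Rightarrow> 'a" where
  "diff scale gr br n f =
     (if n = 0 then (\<lambda>xs. if length xs = 1 then br (f []) (hd xs) else 0)
      else (let c = component (hom_forms scale gr n) f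
            in \<Sum>m\<in>{m. c m \<noteq> 0}. multilinear_extension gr (n + 1) (diff_hom scale br n m (c m))))"

section \<open>Well-definedness of the homogeneous components\<close>

lemma is_decompositionI:
  assumes "\<And>i. c i \<in> A i" "finite S" "\<And>i. i \<notin> S \<Longrightarrow> c i = 0" "x = sum c S"
  shows "is_decomposition A x c"
proof -
  have sub: "{i. c i \<noteq> 0} \<subseteq> S" using assms(3) by blast
  have "sum c {i. c i \<noteq> 0} = sum c S"
    by (rule sum.mono_neutral_left) (use assms(2) sub in auto)
  then show ?thesis
    using assms(1,4) finite_subset[OF sub assms(2)] by (simp add: is_decomposition_def)
qed

context gerstenhaber_algebra
begin

lemma component_gr_eqI: "is_decomposition gr x c \<Longrightarrow> component gr x = c"
  unfolding component_def using direct_sum_gr[of x] by (intro the1_equality)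

lemma component_gr_hom:
  assumes "x \<in> gr i"
  shows "component gr x = (\<lambda>j. if j = i then x else 0)"
  by (rule component_gr_eqI, rule is_decompositionI[where S = "{i}"])
    (use assms subspace_gr subspace_0 in auto)

lemma multilinear_eqI:
  assumes f: "multilinear scale n f" and g: "multilinear scale n g"
    and eq: "\<And>xs ds. length xs = n \<Longrightarrow> homogeneous_list gr xs ds \<Longrightarrow> f xs = g xs"
  shows "f = g"
proof -
  have main: "k \<le> n \<Longrightarrow> \<forall>xs. length xs = n \<longrightarrow> (\<forall>i<n. k \<le> i \<longrightarrow> (\<exists>d. xs ! i \<in> gr d)) \<longrightarrow> f xs = g xs" for k
  proof (induction k)
    case 0
    show ?case
    proof (intro allI impI)
      fix xs assume xs: "length xs = n" "\<forall>i<n. 0 \<le> i \<longrightarrow> (\<exists>d. xs ! i \<in> gr d)"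
      then have "\<forall>i. \<exists>d. i < n \<longrightarrow> xs ! i \<in> gr d" by blast
      from choice[OF this] obtain D where "\<forall>i. i < n \<longrightarrow> xs ! i \<in> gr (D i)" by blast
      then have "homogeneous_list gr xs (map D [0..<n])"
        using xs(1) by (simp add: homogeneous_list_def list_all2_conv_all_nth)
      with eq xs(1) show "f xs = g xs" by blast
    qed
  next
    case (Suc k)
    show ?case
    proof (intro allI impI)
      fix xs assume xs: "length xs = n" "\<forall>i<n. Suc k \<le> i \<longrightarrow> (\<exists>d. xs ! i \<in> gr d)"
      have k: "k < n" using Suc.prems by simp
      obtain c where c: "is_decomposition gr (xs ! k) c" using direct_sum_gr by blast
      have ck: "\<And>i. c i \<in> gr i" and ceq: "xs ! k = (\<Sum>i\<in>{i. c i \<noteq> 0}. c i)"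
        using c by (auto simp: is_decomposition_def)
      have expand: "h xs = (\<Sum>i\<in>{i. c i \<noteq> 0}. h (xs[k := c i]))" if h: "multilinear scale n h" for h
      proof -
        interpret l: Vector_Spaces.linear scale scale "\<lambda>x. h (xs[k := x])"
          using h k xs(1) by (simp add: multilinear_def)
        have "h xs = h (xs[k := xs ! k])" by simp
        also have "\<dots> = (\<Sum>i\<in>{i. c i \<noteq> 0}. h (xs[k := c i]))" unfolding ceq by (rule l.sum)
        finally show ?thesis .
      qed
      have "f (xs[k := c i]) = g (xs[k := c i])" for i
      proof -
        have "\<exists>d. xs[k := c i] ! p \<in> gr d" if "p < n" "k \<le> p" for p
          using that ck xs by (cases "p = k") auto
        moreover have "length (xs[k := c i]) = n" using xs(1) by simp
        ultimately show ?thesis using Suc.IH Suc.prems by simp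
      qed
      then show "f xs = g xs" using expand[OF f] expand[OF g] by simp
    qed
  qed
  show ?thesis
  proof
    fix xs show "f xs = g xs"
      using main[of n] f g by (cases "length xs = n") (auto simp: multilinear_def)
  qed
qed

lemma hom_forms_decomposition_unique:
  assumes "is_decomposition (hom_forms scale gr n) f c" "is_decomposition (hom_forms scale gr n) f c'"
  shows "c = c'"
proof
  fix m
  have dec: "is_decomposition gr (f xs) (\<lambda>k. b (k - sum_list ds) xs)"
    if b: "is_decomposition (hom_forms scale gr n) f b"
      and xs: "length xs = n" "homogeneous_list gr xs ds" for b xs ds
  proof (rule is_decompositionI[where S = "(\<lambda>m. m + sum_list ds) ` {m. b m \<noteq> 0}"])
    show "b (i - sum_list ds) xs \<in> gr i" for i
    proof -
      have "b (i - sum_list ds) \<in> hom_forms scale gr n (i - sum_list ds)"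
        using b by (simp add: is_decomposition_def)
      then have "b (i - sum_list ds) xs \<in> gr (i - sum_list ds + sum_list ds)"
        using xs unfolding hom_forms_def homogeneous_map_def by blast
      then show ?thesis by simp
    qed
    show "finite ((\<lambda>m. m + sum_list ds) ` {m. b m \<noteq> 0})"
      using b by (simp add: is_decomposition_def)
    show "b (i - sum_list ds) xs = 0" if "i \<notin> (\<lambda>m. m + sum_list ds) ` {m. b m \<noteq> 0}" for i
    proof -
      have "b (i - sum_list ds) = 0" using that by force
      then show ?thesis by simp
    qed
    have ev: "(\<Sum>i\<in>S. b i) xs = (\<Sum>i\<in>S. b i xs)" for S
      by (induction S rule: infinite_finite_induct) auto
    have "f xs = (\<Sum>i\<in>{m. b m \<noteq> 0}. b i xs)"
      using b by (simp add: is_decomposition_def flip: ev)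
    then show "f xs = (\<Sum>k\<in>(\<lambda>m. m + sum_list ds) ` {m. b m \<noteq> 0}. b (k - sum_list ds) xs)"
      by (simp add: sum.reindex)
  qed
  show "c m = c' m"
  proof (rule multilinear_eqI)
    show "multilinear scale n (c m)" "multilinear scale n (c' m)"
      using assms by (auto simp: is_decomposition_def hom_forms_def)
    fix xs ds assume xs: "length xs = n" "homogeneous_list gr xs ds"
    have "(\<lambda>k. c (k - sum_list ds) xs) = (\<lambda>k. c' (k - sum_list ds) xs)"
      using dec[OF assms(1) xs] dec[OF assms(2) xs] direct_sum_gr[of "f xs"] by blast
    from fun_cong[OF this, of "m + sum_list ds"] show "c m xs = c' m xs" by simp
  qed
qed

lemma zero_in_hom_forms: "0 \<in> hom_forms scale gr n m"
proof -
  have "Vector_Spaces.linear scale scale (\<lambda>x. 0)"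
    by unfold_locales (auto simp: scale_right_distrib scale_left_distrib)
  moreover have "0 \<in> gr i" for i using subspace_gr subspace_0 by blast
  ultimately show ?thesis
    by (simp add: hom_forms_def multilinear_def homogeneous_map_def graded_antisymmetric_def
        derivation_last_def)
qed

lemma component_hom_form:
  assumes "f \<in> hom_forms scale gr n m"
  shows "component (hom_forms scale gr n) f = (\<lambda>j. if j = m then f else 0)"
proof -
  have "is_decomposition (hom_forms scale gr n) f (\<lambda>j. if j = m then f else 0)"
    by (rule is_decompositionI[where S = "{m}"]) (use assms zero_in_hom_forms in auto)
  then show ?thesis
    unfolding component_def using hom_forms_decomposition_unique by blast
qed

text \<open>On homogeneous forms and nonzero homogeneous arguments, \<open>diff\<close> is given by the formula.\<close>

lemma diff_homogeneous:
  assumes "n \<ge> 1" "f \<in> hom_forms scale gr n m" "length xs = n + 1" "homogeneous_list gr xs ds"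
    and "0 \<notin> set xs"
  shows "diff scale gr br n f xs = diff_hom scale br n m f ds xs"
proof -
  have nz: "homogeneous_list gr xs ds \<Longrightarrow> 0 \<notin> set xs \<Longrightarrow>
      listset (map (\<lambda>x. {i. component gr x i \<noteq> 0}) xs) = {ds} \<and> map2 (component gr) xs ds = xs"
    for xs ds unfolding homogeneous_list_def
  proof (induction rule: list_all2_induct)
    case (Cons x xs d ds)
    then have "{i. component gr x i \<noteq> 0} = {d}"
      by (auto simp: component_gr_hom[of x d])
    with Cons show ?case by (auto simp: set_Cons_def component_gr_hom[of x d])
  qed auto
  have ext: "multilinear_extension gr (n + 1) F xs = F ds xs" for F
    using nz[OF assms(4,5)] assms(3) by (simp add: multilinear_extension_def)
  show ?thesis
  proof (cases "f = 0")
    case True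
    have "br x 0 = 0" for x
    proof -
      interpret l: Vector_Spaces.linear scale scale "br x" by (rule linear_br_right)
      show ?thesis by (rule l.zero)
    qed
    then show ?thesis using True assms(1) component_hom_form[OF assms(2)]
      by (simp add: diff_def Let_def diff_hom_def)
  next
    case False
    then have "{j. (if j = m then f else 0) \<noteq> 0} = {m}" by auto
    then show ?thesis using assms(1) component_hom_form[OF assms(2)]
      by (simp add: diff_def Let_def ext[simplified])
  qed
qed

end

section \<open>Complexes\<close>

definition cochain_complex ::
    "('k::field \<Rightarrow> 'b::ab_group_add \<Rightarrow> 'b) \<Rightarrow> (nat \<Rightarrow> 'b set) \<Rightarrow> (nat \<Rightarrow> 'b \<Rightarrow> 'b) \<Rightarrow> bool" where
  "cochain_complex s V \<delta> \<longleftrightarrow>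
     vector_space s \<and> (\<forall>n. module.subspace s (V n)) \<and>
     (\<forall>n. \<forall>f\<in>V n. \<forall>g\<in>V n. \<delta> n (f + g) = \<delta> n f + \<delta> n g) \<and>
     (\<forall>n c. \<forall>f\<in>V n. \<delta> n (s c f) = s c (\<delta> n f)) \<and>
     (\<forall>n. \<forall>f\<in>V n. \<delta> n f \<in> V (n + 1)) \<and>
     (\<forall>n. \<forall>f\<in>V n. \<delta> (n + 1) (\<delta> n f) = 0)"

definition subcomplex ::
    "('k::field \<Rightarrow> 'b::ab_group_add \<Rightarrow> 'b) \<Rightarrow> (nat \<Rightarrow> 'b set) \<Rightarrow> (nat \<Rightarrow> 'b set) \<Rightarrow>
      (nat \<Rightarrow> 'b \<Rightarrow> 'b) \<Rightarrow> bool" where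
  "subcomplex s W V \<delta> \<longleftrightarrow>
     cochain_complex s V \<delta> \<and> (\<forall>n. W n \<subseteq> V n \<and> module.subspace s (W n)) \<and>
     (\<forall>n. \<forall>f\<in>W n. \<delta> n f \<in> W (n + 1))"

end

theory Submission
  imports Defs
begin

text \<open>
  Write \<open>\<bar>x\<bar> = deg x - 1\<close> for the shifted degree.  In terms of it the bracket is a graded Lie bracket, an
  \<open>n\<close>-form of degree \<open>m\<close> is a map of shifted degree \<open>m + n - 1\<close> that is antisymmetric in the graded
  sense, and the differential is the Chevalley--Eilenberg differential of this Lie algebra with
  coefficients in the adjoint representation; it does not change the shifted degree.

  The sums that define the differential can be replaced by a recursion on the list of arguments.  Let
  \<open>\<iota>\<^sub>x\<close> be insertion of \<open>x\<close> in the first slot and \<open>L\<^sub>x\<close> the Lie derivative along \<open>x\<close>.  Then (with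
  signs dropped) \<open>\<iota>\<^sub>y L\<^sub>x = L\<^sub>x \<iota>\<^sub>y - \<iota>\<^bsub>[x,y]\<^esub>\<close> together with \<open>(L\<^sub>x f)() = [x, f()]\<close> determines \<open>L\<^sub>x\<close>, and
  Cartan's formula \<open>\<iota>\<^sub>x d = L\<^sub>x - d \<iota>\<^sub>x\<close> together with \<open>(d f)() = 0\<close> determines \<open>d\<close>.  These are the functions
  \<open>Lie\<close> and \<open>cartan_diff\<close> below.  From the recursion three inductions on the number of arguments give
  \<open>[L\<^sub>x, L\<^sub>y] = L\<^bsub>[x,y]\<^esub>\<close> (the Jacobi identity), then \<open>L\<^sub>x d = d L\<^sub>x\<close>, and then
  \<open>\<iota>\<^sub>x d d = L\<^sub>x d - d L\<^sub>x + d d \<iota>\<^sub>x = 0\<close>: see \<open>Lie_commutator\<close>, \<open>Lie_cartan_diff_commute\<close> and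
  \<open>cartan_diff_cartan_diff\<close>.  That \<open>d\<close> preserves antisymmetry and the derivation property also follows
  by induction; the derivation property starts from the Leibniz rule for the bracket, which makes the
  commutator of the derivations \<open>[x, -]\<close> and \<open>f\<close> a derivation.

  The recursion agrees with the sums on antisymmetric maps (\<open>cartan_diff_explicit\<close>), because the sums move
  each bracket \<open>[x\<^sub>i, x\<^sub>j]\<close> to the first slot while the Lie derivative leaves it where \<open>x\<^sub>j\<close> was.  What is
  left is linear algebra: the sums make sense on homogeneous arguments only, and their multilinear
  extension is again a form; a general form is a finite sum of homogeneous ones; and a small \<open>n\<close>-form
  with \<open>n \<ge> 1\<close> is the same as a homogeneous \<open>n\<close>-form of degree \<open>-n\<close>.  For \<open>n = 0\<close> the differential of \<open>g\<close>
  is \<open>[g, -]\<close>, which is minus what the recursion gives for the map without arguments with value \<open>g\<close>; the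
  sign does not matter for \<open>d d = 0\<close>.
\<close>

section \<open>Signs and shifted degrees\<close>

definition signed :: "int \<Rightarrow> 'a::ab_group_add \<Rightarrow> 'a" where
  "signed k x = (if even k then x else - x)"

lemma signed_diff: "signed k (x - y) = signed k x - signed k y"
  and signed_minus: "signed k (- x) = - signed k x"
  and signed_zero: "signed k 0 = 0"
  and signed_signed: "signed k (signed l x) = signed (k + l) x"
  by (auto simp: signed_def)

lemma signed_sum: "signed k (sum f A) = (\<Sum>a\<in>A. signed k (f a))"
  by (simp add: signed_def sum_negf)

context gerstenhaber_algebra
begin

lemma scale_minus_one_powi: "scale ((-1) powi k) x = signed k x"
  by (simp add: signed_def power_int_minus_one_minus power_int_def minus_one_power_iff even_nat_iff)

lemma br_add_right: "br x (y + z) = br x y + br x z"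
  and br_diff_right: "br x (y - z) = br x y - br x z"
  and br_minus_right: "br x (- y) = - br x y"
  and br_zero_right: "br x 0 = 0"
  and br_scale_right: "br x (scale c y) = scale c (br x y)"
proof -
  interpret l: Vector_Spaces.linear scale scale "br x" by (rule linear_br_right)
  show "br x (y + z) = br x y + br x z" "br x (y - z) = br x y - br x z" "br x (- y) = - br x y"
    "br x 0 = 0" "br x (scale c y) = scale c (br x y)"
    by (simp_all add: l.add l.diff l.neg l.scale l.zero)
qed

lemma br_add_left: "br (x + y) z = br x z + br y z"
  and br_zero_left: "br 0 z = 0"
  and br_scale_left: "br (scale c x) z = scale c (br x z)"
proof -
  interpret l: Vector_Spaces.linear scale scale "\<lambda>x. br x z" by (rule linear_br_left)
  show "br (x + y) z = br x z + br y z"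
    "br 0 z = 0" "br (scale c x) z = scale c (br x z)"
    by (simp_all add: l.add l.scale l.zero)
qed

lemma br_signed_right: "br x (signed k y) = signed k (br x y)"
  by (simp add: signed_def br_minus_right)

lemma gr_add: "x \<in> gr i \<Longrightarrow> y \<in> gr i \<Longrightarrow> x + y \<in> gr i"
  using subspace_gr subspace_add by blast

lemma gr_diff: "x \<in> gr i \<Longrightarrow> y \<in> gr i \<Longrightarrow> x - y \<in> gr i"
  using subspace_gr subspace_diff by blast

lemma gr_neg: "x \<in> gr i \<Longrightarrow> - x \<in> gr i"
  using subspace_gr subspace_neg by blast

lemma gr_zero: "0 \<in> gr i"
  using subspace_gr subspace_0 by blast

lemma gr_signed: "x \<in> gr i \<Longrightarrow> signed k x \<in> gr i"
  by (simp add: signed_def gr_neg)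

text \<open>
  A homogeneous element is paired with its shifted degree: the zero element has every degree, so the
  signs cannot be read off from the element alone.
\<close>

definition hom_pair :: "'a \<times> int \<Rightarrow> bool" where
  "hom_pair p \<longleftrightarrow> fst p \<in> gr (snd p + 1)"

definition pair_br :: "'a \<times> int \<Rightarrow> 'a \<times> int \<Rightarrow> 'a \<times> int" where
  "pair_br p q = (br (fst p) (fst q), snd p + snd q)"

lemma pair_br_simps [simp]: "fst (pair_br p q) = br (fst p) (fst q)" "snd (pair_br p q) = snd p + snd q"
  by (simp_all add: pair_br_def)

lemma hom_pair_pair_br: "hom_pair p \<Longrightarrow> hom_pair q \<Longrightarrow> hom_pair (pair_br p q)"
  using br_gr[of "fst p" "snd p + 1" "fst q" "snd q + 1"] by (simp add: hom_pair_def algebra_simps)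

lemma br_jacobi_shifted:
  assumes "x \<in> gr (i + 1)" "y \<in> gr (j + 1)" "z \<in> gr (l + 1)"
  shows "br x (br y z) = br (br x y) z + signed (i * j) (br y (br x z))"
  using br_jacobi[OF assms] by (simp add: scale_minus_one_powi)

lemma br_antisym_shifted:
  assumes "x \<in> gr (i + 1)" "y \<in> gr (j + 1)"
  shows "br x y = - signed (i * j) (br y x)"
  using br_antisym[OF assms] by (simp add: scale_minus_one_powi)

lemma br_leibniz_shifted:
  assumes "x \<in> gr (i + 1)" "y \<in> gr j" "z \<in> gr l"
  shows "br x (y * z) = br x y * z + signed (j * i) (y * br x z)"
  using br_leibniz[OF assms] by (simp add: scale_minus_one_powi)

text \<open>
  Maps are functions on lists of pairs of arbitrary length.  Leaving the arity open lets insertion of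
  an argument preserve all the properties below, and shifted degrees make the conditions
  independent of the arity.
\<close>

definition graded_map :: "int \<Rightarrow> (('a \<times> int) list \<Rightarrow> 'a) \<Rightarrow> bool" where
  "graded_map m F \<longleftrightarrow> (\<forall>ps. list_all hom_pair ps \<longrightarrow> F ps \<in> gr (m + sum_list (map snd ps) + 1))"

definition slot_additive :: "(('a \<times> int) list \<Rightarrow> 'a) \<Rightarrow> bool" where
  "slot_additive F \<longleftrightarrow>
     (\<forall>ps a b d qs. F (ps @ (a + b, d) # qs) = F (ps @ (a, d) # qs) + F (ps @ (b, d) # qs))"

definition antisymmetric :: "(('a \<times> int) list \<Rightarrow> 'a) \<Rightarrow> bool" where
  "antisymmetric F \<longleftrightarrow>
     (\<forall>ps p q qs. list_all hom_pair (ps @ p # q # qs) \<longrightarrow>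
        F (ps @ p # q # qs) = - signed (snd p * snd q) (F (ps @ q # p # qs)))"

definition derivation :: "int \<Rightarrow> (('a \<times> int) list \<Rightarrow> 'a) \<Rightarrow> bool" where
  "derivation m F \<longleftrightarrow>
     (\<forall>ps y j z l. list_all hom_pair ps \<longrightarrow> y \<in> gr (j + 1) \<longrightarrow> z \<in> gr (l + 1) \<longrightarrow>
        F (ps @ [(y * z, j + l + 1)]) =
          signed ((j + 1) * (m + sum_list (map snd ps))) (y * F (ps @ [(z, l)])) + F (ps @ [(y, j)]) * z)"

section \<open>The Lie derivative and the differential by recursion\<close>

text \<open>
  The closed form is \<open>(L\<^sub>x F)(y\<^sub>1,\<dots>,y\<^sub>n) = [x, F(y\<^sub>1,\<dots>,y\<^sub>n)] - \<Sum>\<^sub>j \<plusminus>F(y\<^sub>1,\<dots>,[x,y\<^sub>j],\<dots>,y\<^sub>n)\<close>, with the sign of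
  moving \<open>x\<close> past \<open>F\<close> and \<open>y\<^sub>1,\<dots>,y\<^bsub>j-1\<^esub>\<close>.  The number \<open>m\<close> is the shifted degree of \<open>F\<close>; after insertion of
  \<open>q\<close> it becomes \<open>m + snd q\<close>.
\<close>

primrec Lie :: "'a \<times> int \<Rightarrow> int \<Rightarrow> (('a \<times> int) list \<Rightarrow> 'a) \<Rightarrow> ('a \<times> int) list \<Rightarrow> 'a" where
  "Lie p m F [] = br (fst p) (F [])"
| "Lie p m F (q # qs) =
     Lie p (m + snd q) (\<lambda>rs. F (q # rs)) qs - signed (snd p * m) (F (pair_br p q # qs))"

lemma Lie_diff: "Lie p m (\<lambda>ps. F ps - G ps) qs = Lie p m F qs - Lie p m G qs"
  by (induction qs arbitrary: m F G) (simp_all add: br_diff_right signed_diff)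

lemma Lie_signed: "Lie p m (\<lambda>ps. signed k (F ps)) qs = signed k (Lie p m F qs)"
  by (induction qs arbitrary: m F)
    (simp_all add: br_signed_right signed_diff signed_signed add.commute)

text \<open>
  Cartan's formula for \<open>\<iota>\<^sub>q d\<close> taken as a definition.  With \<open>q\<close> in front, \<open>L\<^sub>q F\<close> carries the sign of moving
  \<open>q\<close> past \<open>F\<close>.
\<close>

primrec cartan_diff :: "int \<Rightarrow> (('a \<times> int) list \<Rightarrow> 'a) \<Rightarrow> ('a \<times> int) list \<Rightarrow> 'a" where
  "cartan_diff m F [] = 0"
| "cartan_diff m F (q # qs) =
     signed (snd q * m) (Lie q m F qs) - cartan_diff (m + snd q) (\<lambda>rs. F (q # rs)) qs"

lemma cartan_diff_diff: "cartan_diff m (\<lambda>ps. F ps - G ps) qs = cartan_diff m F qs - cartan_diff m G qs"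
  by (induction qs arbitrary: m F G) (simp_all add: Lie_diff signed_diff)

lemma cartan_diff_signed: "cartan_diff m (\<lambda>ps. signed k (F ps)) qs = signed k (cartan_diff m F qs)"
  by (induction qs arbitrary: m F) (simp_all add: Lie_signed signed_diff signed_zero signed_signed add.commute)

lemma slot_additive_Cons: "slot_additive F \<Longrightarrow> slot_additive (\<lambda>ps. F (p # ps))"
  unfolding slot_additive_def by (metis append_Cons)

lemma graded_map_Cons: "graded_map m F \<Longrightarrow> hom_pair p \<Longrightarrow> graded_map (m + snd p) (\<lambda>ps. F (p # ps))"
  unfolding graded_map_def
  by (metis (no_types, lifting) ab_semigroup_add_class.add_ac(1) list.pred_inject(2) list.simps(9) sum_list.Cons)

lemma antisymmetric_Cons: "antisymmetric F \<Longrightarrow> hom_pair p \<Longrightarrow> antisymmetric (\<lambda>ps. F (p # ps))"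
  unfolding antisymmetric_def by (metis append_Cons list.pred_inject(2))

lemma derivation_Cons:
  assumes "derivation m F" "hom_pair p"
  shows "derivation (m + snd p) (\<lambda>ps. F (p # ps))"
  unfolding derivation_def
proof (intro allI impI)
  fix ps y j z l assume "list_all hom_pair ps" "y \<in> gr (j + 1)" "z \<in> gr (l + 1)"
  then show "F (p # ps @ [(y * z, j + l + 1)]) =
      signed ((j + 1) * (m + snd p + sum_list (map snd ps))) (y * F (p # ps @ [(z, l)])) + F (p # ps @ [(y, j)]) * z"
    using assms(1)[unfolded derivation_def, rule_format, of "p # ps" y j z l] assms(2)
    by (simp add: add.assoc)
qed

lemma slot_additive_minus: "slot_additive F \<Longrightarrow> F (ps @ (- a, d) # qs) = - F (ps @ (a, d) # qs)"
proof -
  assume F: "slot_additive F"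
  have z: "F (ps @ (0, d) # qs) = 0"
    using F[unfolded slot_additive_def, rule_format, of ps 0 0 d qs] by simp
  show ?thesis
    using F[unfolded slot_additive_def, rule_format, of ps "- a" a d qs] z by (simp add: eq_neg_iff_add_eq_0)
qed

lemma slot_additive_signed:
  "slot_additive F \<Longrightarrow> F (ps @ (signed k a, d) # qs) = signed k (F (ps @ (a, d) # qs))"
  by (simp add: signed_def slot_additive_minus)

lemma slot_additive_jacobi:
  assumes "slot_additive F" "hom_pair p" "hom_pair q" "hom_pair r"
  shows "F (pair_br p (pair_br q r) # rs) =
    F (pair_br (pair_br p q) r # rs) + signed (snd p * snd q) (F (pair_br q (pair_br p r) # rs))"
proof -
  have "F ([] @ (br (fst p) (br (fst q) (fst r)), snd p + (snd q + snd r)) # rs) =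
     F ([] @ (br (br (fst p) (fst q)) (fst r), snd p + (snd q + snd r)) # rs) +
     signed (snd p * snd q) (F ([] @ (br (fst q) (br (fst p) (fst r)), snd p + (snd q + snd r)) # rs))"
    using assms br_jacobi_shifted[of "fst p" "snd p" "fst q" "snd q" "fst r" "snd r"]
    by (simp only: slot_additive_signed[OF assms(1), symmetric])
      (simp add: hom_pair_def assms(1)[unfolded slot_additive_def, rule_format, of "[]", simplified])
  then show ?thesis by (simp add: pair_br_def ac_simps)
qed

section \<open>The differential squares to zero\<close>

text \<open>
  Inserting \<open>r\<close> on both sides, the mixed terms \<open>L\<^sub>p \<iota>\<^bsub>[q,r]\<^esub>\<close> and \<open>L\<^sub>q \<iota>\<^bsub>[p,r]\<^esub>\<close> cancel, and what remains is the
  Jacobi identity for \<open>p\<close>, \<open>q\<close>, \<open>r\<close> in the first slot.  With no arguments left it is the Jacobi identity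
  for \<open>p\<close>, \<open>q\<close> and the value of \<open>F\<close>.
\<close>

lemma Lie_commutator:
  assumes "slot_additive F" "graded_map m F" "hom_pair p" "hom_pair q" "list_all hom_pair rs"
  shows "Lie p (m + snd q) (Lie q m F) rs =
    Lie (pair_br p q) m F rs + signed (snd p * snd q) (Lie q (m + snd p) (Lie p m F) rs)"
  using assms
proof (induction rs arbitrary: m F)
  case Nil
  then have "F [] \<in> gr (m + 1)"
    unfolding graded_map_def by (metis add.right_neutral list.pred_inject(1) list.simps(8) sum_list.Nil)
  then show ?case
    using Nil.prems(3,4) br_jacobi_shifted[of "fst p" "snd p" "fst q" "snd q" "F []" m]
    by (simp add: hom_pair_def)
next
  case (Cons r rs)
  have r: "hom_pair r" "list_all hom_pair rs" using Cons.prems by auto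
  note IH = Cons.IH[OF slot_additive_Cons[OF Cons.prems(1), of r] graded_map_Cons[OF Cons.prems(2) r(1)] Cons.prems(3,4) r(2)]
  note J = slot_additive_jacobi[OF Cons.prems(1,3,4) r(1), of rs]
  have e: "Lie p (m + snd q) (Lie q m F) (r # rs) =
      Lie p (m + snd r + snd q) (Lie q (m + snd r) (\<lambda>ts. F (r # ts))) rs
      - signed (snd q * m) (Lie p (m + snd q + snd r) (\<lambda>ts. F (pair_br q r # ts)) rs)
      - signed (snd p * (m + snd q)) (Lie q (m + snd p + snd r) (\<lambda>ts. F (pair_br p r # ts)) rs)
      + signed (snd p * (m + snd q) + snd q * m) (F (pair_br q (pair_br p r) # rs))" for p q
    by (simp add: Lie_diff Lie_signed signed_diff signed_signed ac_simps)
  show ?case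
    unfolding e Lie.simps(2)[of "pair_br p q"] IH J
    by (cases "even (snd p)"; cases "even (snd q)"; cases "even m")
      (simp_all add: signed_def J)
qed

text \<open>
  After insertion of \<open>r\<close>, Cartan's formula turns the difference of the two sides into
  \<open>[L\<^sub>p, L\<^sub>r] - L\<^bsub>[p,r]\<^esub>\<close> and the same difference for \<open>\<iota>\<^sub>r F\<close>.
\<close>

lemma Lie_cartan_diff_commute:
  assumes "slot_additive F" "graded_map m F" "hom_pair p" "list_all hom_pair rs"
  shows "Lie p m (cartan_diff m F) rs = cartan_diff (m + snd p) (Lie p m F) rs"
  using assms
proof (induction rs arbitrary: m F)
  case Nil
  then show ?case by (simp add: br_zero_right)
next
  case (Cons r rs)
  have r: "hom_pair r" "list_all hom_pair rs" using Cons.prems by auto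
  note IH = Cons.IH[OF slot_additive_Cons[OF Cons.prems(1), of r] graded_map_Cons[OF Cons.prems(2) r(1)] Cons.prems(3) r(2)]
  have c: "Lie p (m + snd r) (Lie r m F) rs =
    Lie (pair_br p r) m F rs + signed (snd p * snd r) (Lie r (m + snd p) (Lie p m F) rs)"
    using Lie_commutator Cons.prems r by blast
  have e: "cartan_diff (m + snd p) (Lie p m F) (r # rs) =
     signed (snd r * (m + snd p)) (Lie r (m + snd p) (Lie p m F) rs)
     - cartan_diff (m + snd r + snd p) (Lie p (m + snd r) (\<lambda>ts. F (r # ts))) rs
     + signed (snd p * m) (cartan_diff (m + (snd p + snd r)) (\<lambda>ts. F (pair_br p r # ts)) rs)"
    by (simp add: cartan_diff_diff cartan_diff_signed ac_simps)
  have e2: "Lie p m (cartan_diff m F) (r # rs) = signed (snd r * m) (Lie p (m + snd r) (Lie r m F) rs)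
     - Lie p (m + snd r) (cartan_diff (m + snd r) (\<lambda>ts. F (r # ts))) rs
     - signed (snd p * m) (signed ((snd p + snd r) * m) (Lie (pair_br p r) m F rs)
         - cartan_diff (m + (snd p + snd r)) (\<lambda>ts. F (pair_br p r # ts)) rs)"
    by (simp add: Lie_diff Lie_signed)
  show ?case
    unfolding e e2 IH c
    by (cases "even (snd p)"; cases "even (snd r)"; cases "even m") (simp_all add: signed_def)
qed

lemma cartan_diff_cartan_diff:
  assumes "slot_additive F" "graded_map m F" "list_all hom_pair rs"
  shows "cartan_diff m (cartan_diff m F) rs = 0"
  using assms
proof (induction rs arbitrary: m F)
  case (Cons r rs)
  have r: "hom_pair r" "list_all hom_pair rs" using Cons.prems by auto
  note IH = Cons.IH[OF slot_additive_Cons[OF Cons.prems(1), of r] graded_map_Cons[OF Cons.prems(2) r(1)] r(2)]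
  show ?case
    using Lie_cartan_diff_commute[OF Cons.prems(1,2) r] IH
    by (simp add: cartan_diff_diff cartan_diff_signed)
qed simp

section \<open>The differential preserves the conditions on forms\<close>

lemma graded_map_Lie:
  assumes "graded_map m F" "hom_pair p"
  shows "graded_map (m + snd p) (Lie p m F)"
proof -
  have "Lie p m F rs \<in> gr (m + snd p + sum_list (map snd rs) + 1)"
    if "graded_map m F" "list_all hom_pair rs" for rs
    using that
  proof (induction rs arbitrary: m F)
    case Nil
    then have "F [] \<in> gr (m + 1)"
      unfolding graded_map_def by (metis add.right_neutral list.pred_inject(1) list.simps(8) sum_list.Nil)
    then show ?case using assms(2) br_gr[of "fst p" "snd p + 1" "F []" "m + 1"]
      by (simp add: hom_pair_def ac_simps)
  next
    case (Cons r rs)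
    then have "Lie p (m + snd r) (\<lambda>ts. F (r # ts)) rs \<in> gr (m + snd p + sum_list (map snd (r # rs)) + 1)"
      using Cons.IH[of "m + snd r" "\<lambda>ts. F (r # ts)"] graded_map_Cons by (simp add: ac_simps)
    moreover have "F (pair_br p r # rs) \<in> gr (m + snd p + sum_list (map snd (r # rs)) + 1)"
      using Cons.prems(1)[unfolded graded_map_def, rule_format, of "pair_br p r # rs"] Cons.prems(2) assms(2)
      by (simp add: hom_pair_pair_br ac_simps)
    ultimately show ?case by (auto intro!: gr_diff gr_signed)
  qed
  then show ?thesis using assms(1) by (simp add: graded_map_def)
qed

lemma graded_map_cartan_diff:
  assumes "graded_map m F"
  shows "graded_map m (cartan_diff m F)"
proof -
  have "cartan_diff m F rs \<in> gr (m + sum_list (map snd rs) + 1)"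
    if "graded_map m F" "list_all hom_pair rs" for rs
    using that
  proof (induction rs arbitrary: m F)
    case (Cons r rs)
    then have "cartan_diff (m + snd r) (\<lambda>ts. F (r # ts)) rs \<in> gr (m + sum_list (map snd (r # rs)) + 1)"
      using Cons.IH[of "m + snd r" "\<lambda>ts. F (r # ts)"] graded_map_Cons by (simp add: ac_simps)
    moreover have "Lie r m F rs \<in> gr (m + sum_list (map snd (r # rs)) + 1)"
      using graded_map_Lie[OF Cons.prems(1), of r] Cons.prems(2) by (simp add: graded_map_def ac_simps)
    ultimately show ?case by (auto intro!: gr_diff gr_signed)
  qed (simp add: gr_zero)
  then show ?thesis using assms(1) by (simp add: graded_map_def)
qed

text \<open>
  Antisymmetry is known on homogeneous arguments only, so that rewriting with it under \<open>Lie\<close> and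
  \<open>cartan_diff\<close> needs congruence rules.
\<close>

lemma Lie_cong:
  assumes "\<And>ts. list_all hom_pair ts \<Longrightarrow> length ts = length qs \<Longrightarrow> F ts = G ts"
    and "hom_pair p" "list_all hom_pair qs"
  shows "Lie p m F qs = Lie p m G qs"
  using assms(1,3)
proof (induction qs arbitrary: m F G)
  case Nil
  then show ?case by simp
next
  case (Cons q qs)
  have q: "hom_pair q" "list_all hom_pair qs" using Cons.prems by auto
  have "Lie p (m + snd q) (\<lambda>ts. F (q # ts)) qs = Lie p (m + snd q) (\<lambda>ts. G (q # ts)) qs"
    using Cons.IH[of "\<lambda>ts. F (q # ts)" "\<lambda>ts. G (q # ts)"] Cons.prems(1) q by simp
  moreover have "F (pair_br p q # qs) = G (pair_br p q # qs)"
    using Cons.prems(1) q assms(2) by (simp add: hom_pair_pair_br)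
  ultimately show ?case by simp
qed

lemma cartan_diff_cong:
  assumes "\<And>ts. list_all hom_pair ts \<Longrightarrow> Suc (length ts) = length qs \<Longrightarrow> F ts = G ts"
    and "list_all hom_pair qs"
  shows "cartan_diff m F qs = cartan_diff m G qs"
  using assms
proof (induction qs arbitrary: m F G)
  case (Cons q qs)
  have q: "hom_pair q" "list_all hom_pair qs" using Cons.prems by auto
  have "cartan_diff (m + snd q) (\<lambda>ts. F (q # ts)) qs = cartan_diff (m + snd q) (\<lambda>ts. G (q # ts)) qs"
    using Cons.IH[of "\<lambda>ts. F (q # ts)" "\<lambda>ts. G (q # ts)"] Cons.prems(1) q by simp
  moreover have "Lie q m F qs = Lie q m G qs"
    using Cons.prems(1) q by (intro Lie_cong) auto
  ultimately show ?case by simp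
qed simp

lemma antisymmetric_swap:
  assumes "antisymmetric F" "hom_pair p" "hom_pair q" "list_all hom_pair qs"
  shows "F (p # q # qs) = signed (snd p * snd q + 1) (F (q # p # qs))"
proof -
  have "F ([] @ p # q # qs) = - signed (snd p * snd q) (F ([] @ q # p # qs))"
    using assms(1)[unfolded antisymmetric_def, rule_format, of "[]" p q qs] assms(2-4) by simp
  then show ?thesis by (simp add: signed_def)
qed

lemma antisymmetric_Lie:
  assumes "antisymmetric F" "hom_pair p"
  shows "antisymmetric (Lie p m F)"
proof -
  have "Lie p m F (ps @ a # b # qs) = - signed (snd a * snd b) (Lie p m F (ps @ b # a # qs))"
    if "antisymmetric F" "list_all hom_pair (ps @ a # b # qs)" for ps a b qs
    using that
  proof (induction ps arbitrary: m F)
    case Nil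
    have h: "hom_pair a" "hom_pair b" "list_all hom_pair qs" using Nil.prems by auto
    have "Lie p (m + snd a + snd b) (\<lambda>ts. F (a # b # ts)) qs =
        Lie p (m + snd a + snd b) (\<lambda>ts. signed (snd a * snd b + 1) (F (b # a # ts))) qs"
      by (rule Lie_cong) (simp_all add: antisymmetric_swap[OF Nil.prems(1), of a b] h assms(2))
    also have "\<dots> = signed (snd a * snd b + 1) (Lie p (m + snd a + snd b) (\<lambda>ts. F (b # a # ts)) qs)"
      by (rule Lie_signed)
    finally have 1: "Lie p (m + snd a + snd b) (\<lambda>ts. F (a # b # ts)) qs = \<dots>" .
    have 2: "F (a # pair_br p b # qs) = signed (snd a * (snd p + snd b) + 1) (F (pair_br p b # a # qs))"
      using antisymmetric_swap[OF Nil.prems(1), of a "pair_br p b" qs] h assms(2) by (simp add: hom_pair_pair_br)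
    have 3: "F (pair_br p a # b # qs) = signed ((snd p + snd a) * snd b + 1) (F (b # pair_br p a # qs))"
      using antisymmetric_swap[OF Nil.prems(1), of "pair_br p a" b qs] h assms(2) by (simp add: hom_pair_pair_br)
    have e: "Lie p m F (a # b # qs) = Lie p (m + snd a + snd b) (\<lambda>ts. F (a # b # ts)) qs
        - signed (snd p * (m + snd a)) (F (a # pair_br p b # qs)) - signed (snd p * m) (F (pair_br p a # b # qs))"
      and e': "Lie p m F (b # a # qs) = Lie p (m + snd a + snd b) (\<lambda>ts. F (b # a # ts)) qs
        - signed (snd p * (m + snd b)) (F (b # pair_br p a # qs)) - signed (snd p * m) (F (pair_br p b # a # qs))"
      by (simp_all add: ac_simps)
    show ?case
      unfolding append_Nil e e' 1 2 3 signed_diff signed_signed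
      by (cases "even (snd p)"; cases "even (snd a)"; cases "even (snd b)"; simp add: signed_def)
  next
    case (Cons r ps)
    have h: "hom_pair r" "hom_pair a" "hom_pair b" using Cons.prems by auto
    have 1: "Lie p (m + snd r) (\<lambda>ts. F (r # ts)) (ps @ a # b # qs) =
       - signed (snd a * snd b) (Lie p (m + snd r) (\<lambda>ts. F (r # ts)) (ps @ b # a # qs))"
      using Cons.IH[of "\<lambda>ts. F (r # ts)"] antisymmetric_Cons[OF Cons.prems(1) h(1)] Cons.prems(2) by simp
    have 2: "F (pair_br p r # ps @ a # b # qs) = - signed (snd a * snd b) (F (pair_br p r # ps @ b # a # qs))"
      using Cons.prems(1)[unfolded antisymmetric_def, rule_format, of "pair_br p r # ps" a b qs] Cons.prems(2) assms(2)
      by (simp add: hom_pair_pair_br)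
    show ?case by (simp add: 1 2 signed_def)
  qed
  then show ?thesis using assms(1) unfolding antisymmetric_def by blast
qed

text \<open>
  If the swap concerns the first two arguments, Cartan's formula is used twice.  The two Lie
  derivatives are exchanged by the swap; the term with \<open>[a,b]\<close> and the term with both arguments
  inserted in \<open>F\<close> change sign by antisymmetry of the bracket and of \<open>F\<close>.
\<close>

lemma antisymmetric_cartan_diff:
  assumes "antisymmetric F" "slot_additive F"
  shows "antisymmetric (cartan_diff m F)"
proof -
  have "cartan_diff m F (ps @ a # b # qs) = - signed (snd a * snd b) (cartan_diff m F (ps @ b # a # qs))"
    if "antisymmetric F" "slot_additive F" "list_all hom_pair (ps @ a # b # qs)" for ps a b qs
    using that
  proof (induction ps arbitrary: m F)
    case Nil
    have h: "hom_pair a" "hom_pair b" "list_all hom_pair qs" using Nil.prems by auto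
    have "cartan_diff (m + snd a + snd b) (\<lambda>ts. F (a # b # ts)) qs =
        cartan_diff (m + snd a + snd b) (\<lambda>ts. signed (snd a * snd b + 1) (F (b # a # ts))) qs"
      by (rule cartan_diff_cong) (simp_all add: antisymmetric_swap[OF Nil.prems(1), of a b] h)
    also have "\<dots> = signed (snd a * snd b + 1) (cartan_diff (m + snd a + snd b) (\<lambda>ts. F (b # a # ts)) qs)"
      by (rule cartan_diff_signed)
    finally have 1: "cartan_diff (m + snd a + snd b) (\<lambda>ts. F (a # b # ts)) qs = \<dots>" .
    have "br (fst a) (fst b) = signed (snd a * snd b + 1) (br (fst b) (fst a))"
      using br_antisym_shifted[of "fst a" "snd a" "fst b" "snd b"] h by (simp add: hom_pair_def signed_def)
    then have 2: "F (pair_br a b # qs) = signed (snd a * snd b + 1) (F (pair_br b a # qs))"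
      using slot_additive_signed[OF Nil.prems(2), of "[]"] by (simp add: pair_br_def add.commute)
    have e: "cartan_diff m F (a # b # qs) = signed (snd a * m) (Lie a (m + snd b) (\<lambda>ts. F (b # ts)) qs)
        - signed (snd a * m + snd a * m) (F (pair_br a b # qs))
        - signed (snd b * (m + snd a)) (Lie b (m + snd a) (\<lambda>ts. F (a # ts)) qs)
        + cartan_diff (m + snd a + snd b) (\<lambda>ts. F (a # b # ts)) qs"
      and e': "cartan_diff m F (b # a # qs) = signed (snd b * m) (Lie b (m + snd a) (\<lambda>ts. F (a # ts)) qs)
        - signed (snd b * m + snd b * m) (F (pair_br b a # qs))
        - signed (snd a * (m + snd b)) (Lie a (m + snd b) (\<lambda>ts. F (b # ts)) qs)
        + cartan_diff (m + snd a + snd b) (\<lambda>ts. F (b # a # ts)) qs"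
      by (simp_all add: ac_simps signed_diff signed_signed)
    show ?case
      unfolding append_Nil e e' 1 2
      by (cases "even (snd a)"; cases "even (snd b)"; cases "even m")
        (simp_all add: signed_def)
  next
    case (Cons r ps)
    have h: "hom_pair r" "hom_pair a" "hom_pair b" using Cons.prems by auto
    have 1: "cartan_diff (m + snd r) (\<lambda>ts. F (r # ts)) (ps @ a # b # qs) =
       - signed (snd a * snd b) (cartan_diff (m + snd r) (\<lambda>ts. F (r # ts)) (ps @ b # a # qs))"
      using Cons.IH[of "\<lambda>ts. F (r # ts)"] antisymmetric_Cons[OF Cons.prems(1) h(1)]
        slot_additive_Cons[OF Cons.prems(2)] Cons.prems(3) by simp
    have 2: "Lie r m F (ps @ a # b # qs) = - signed (snd a * snd b) (Lie r m F (ps @ b # a # qs))"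
      using antisymmetric_Lie[OF Cons.prems(1) h(1), of m, unfolded antisymmetric_def, rule_format, of ps a b qs]
        Cons.prems(3) by simp
    show ?case by (simp add: 1 2 signed_def)
  qed
  then show ?thesis using assms unfolding antisymmetric_def by blast
qed

text \<open>
  For a single argument, \<open>Lie p m F\<close> is the graded commutator of the derivations \<open>[p, -]\<close> and \<open>F\<close>: expanding
  both compositions on \<open>y * z\<close>, the cross terms \<open>[p,y] * F z\<close> and \<open>F y * [p,z]\<close> cancel.
\<close>

lemma derivation_Lie:
  assumes "derivation m F" "slot_additive F" "graded_map m F" "hom_pair p"
  shows "derivation (m + snd p) (Lie p m F)"
proof -
  have "Lie p m F (ps @ [(y * z, j + l + 1)]) =
      signed ((j + 1) * (m + snd p + sum_list (map snd ps))) (y * Lie p m F (ps @ [(z, l)]))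
      + Lie p m F (ps @ [(y, j)]) * z"
    if "derivation m F" "slot_additive F" "graded_map m F" "list_all hom_pair ps"
      "y \<in> gr (j + 1)" "z \<in> gr (l + 1)" for ps y j z l
    using that
  proof (induction ps arbitrary: m F)
    case Nil
    obtain x d where p: "p = (x, d)" "x \<in> gr (d + 1)" using assms(4) by (cases p) (auto simp: hom_pair_def)
    note der = Nil.prems(1)[unfolded derivation_def, rule_format, of "[]", simplified]
    note gm = Nil.prems(3)[unfolded graded_map_def, rule_format, of "[_]", simplified, unfolded hom_pair_def, simplified]
    have Fz: "F [(z, l)] \<in> gr (m + l + 1)" and Fy: "F [(y, j)] \<in> gr (m + j + 1)"
      using gm[of "(z, l)"] gm[of "(y, j)"] Nil.prems by auto
    have xy: "br x y \<in> gr (d + j + 1)" and xz: "br x z \<in> gr (d + l + 1)"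
      using br_gr[OF p(2) Nil.prems(5)] br_gr[OF p(2) Nil.prems(6)] by (simp_all add: ac_simps)
    have 1: "br x (y * z) = br x y * z + signed ((j + 1) * d) (y * br x z)"
      by (rule br_leibniz_shifted[OF p(2) Nil.prems(5,6)])
    have 2: "F [(br x (y * z), d + (j + l + 1))] =
        F [(br x y * z, d + (j + l + 1))] + signed ((j + 1) * d) (F [(y * br x z, d + (j + l + 1))])"
      unfolding 1 using Nil.prems(2)[unfolded slot_additive_def, rule_format, of "[]" _ _ _ "[]"]
        slot_additive_signed[OF Nil.prems(2), of "[]" _ _ _ "[]"] by simp
    have 4: "F [(br x y * z, d + (j + l + 1))] =
        signed ((d + j + 1) * m) (br x y * F [(z, l)]) + F [(br x y, d + j)] * z"
      using der[of "br x y" "d + j" z l] xy Nil.prems(6) by (simp add: ac_simps)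
    have 5: "F [(y * br x z, d + (j + l + 1))] =
        signed ((j + 1) * m) (y * F [(br x z, d + l)]) + F [(y, j)] * br x z"
      using der[of y j "br x z" "d + l"] xz Nil.prems(5) by (simp add: ac_simps)
    have 3: "br x (F [(y * z, j + l + 1)]) = signed ((j + 1) * m) (br x y * F [(z, l)]
         + signed ((j + 1) * d) (y * br x (F [(z, l)]))) + br x (F [(y, j)]) * z
         + signed ((m + j + 1) * d) (F [(y, j)] * br x z)"
      using br_leibniz_shifted[OF p(2) Nil.prems(5) Fz] br_leibniz_shifted[OF p(2) Fy Nil.prems(6)]
      by (simp add: der[OF Nil.prems(5,6)] br_add_right br_signed_right)
    show ?case
      unfolding p(1)
      by (simp add: pair_br_def 2 3 4 5)
        (cases "even d"; cases "even j"; cases "even m"; simp add: signed_def algebra_simps)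
  next
    case (Cons r ps)
    have h: "hom_pair r" "list_all hom_pair ps" using Cons.prems by auto
    have 1: "Lie p (m + snd r) (\<lambda>ts. F (r # ts)) (ps @ [(y * z, j + l + 1)]) =
      signed ((j + 1) * (m + snd r + snd p + sum_list (map snd ps)))
        (y * Lie p (m + snd r) (\<lambda>ts. F (r # ts)) (ps @ [(z, l)]))
      + Lie p (m + snd r) (\<lambda>ts. F (r # ts)) (ps @ [(y, j)]) * z"
      using Cons.IH[of "m + snd r" "\<lambda>ts. F (r # ts)"] derivation_Cons[OF Cons.prems(1) h(1)]
        slot_additive_Cons[OF Cons.prems(2)] graded_map_Cons[OF Cons.prems(3) h(1)] Cons.prems(5,6) h(2)
      by simp
    have 2: "F (pair_br p r # ps @ [(y * z, j + l + 1)]) =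
      signed ((j + 1) * (m + snd r + snd p + sum_list (map snd ps))) (y * F (pair_br p r # ps @ [(z, l)]))
      + F (pair_br p r # ps @ [(y, j)]) * z"
      using Cons.prems(1)[unfolded derivation_def, rule_format, of "pair_br p r # ps" y j z l] Cons.prems(5,6) h assms(4)
      by (simp add: hom_pair_pair_br ac_simps)
    have e: "m + snd p + sum_list (map snd (r # ps)) = m + snd r + snd p + sum_list (map snd ps)" by simp
    define k where "k = (j + 1) * (m + snd r + snd p + sum_list (map snd ps))"
    show ?case
      unfolding e append_Cons Lie.simps(2) 1 2 k_def[symmetric] by (simp add: signed_def algebra_simps)
  qed
  then show ?thesis using assms by (simp add: derivation_def)
qed

text \<open>
  For a single argument \<open>w\<close> the value is \<open>- [F(), w]\<close>, a derivation by the Leibniz rule.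
\<close>

lemma derivation_cartan_diff:
  assumes "derivation m F" "slot_additive F" "graded_map m F"
  shows "derivation m (cartan_diff m F)"
proof -
  have "cartan_diff m F (ps @ [(y * z, j + l + 1)]) =
      signed ((j + 1) * (m + sum_list (map snd ps))) (y * cartan_diff m F (ps @ [(z, l)]))
      + cartan_diff m F (ps @ [(y, j)]) * z"
    if "derivation m F" "slot_additive F" "graded_map m F" "list_all hom_pair ps"
      "y \<in> gr (j + 1)" "z \<in> gr (l + 1)" for ps y j z l
    using that
  proof (induction ps arbitrary: m F)
    case Nil
    have g: "F [] \<in> gr (m + 1)"
      using Nil.prems(3)[unfolded graded_map_def, rule_format, of "[]"] by simp
    have s: "signed (e * m) (br w (F [])) = - br (F []) w" if "w \<in> gr (e + 1)" for w e
      using br_antisym_shifted[OF that g] by (simp add: signed_signed) (simp add: signed_def)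
    have yz: "y * z \<in> gr (j + l + 1 + 1)"
      using mult_gr[OF Nil.prems(5,6)] by (simp add: ac_simps)
    show ?case
      using br_leibniz_shifted[OF g Nil.prems(5,6)]
      by (simp add: s[OF yz] s[OF Nil.prems(5)] s[OF Nil.prems(6)] signed_minus)
  next
    case (Cons r ps)
    have h: "hom_pair r" "list_all hom_pair ps" using Cons.prems by auto
    have 1: "cartan_diff (m + snd r) (\<lambda>ts. F (r # ts)) (ps @ [(y * z, j + l + 1)]) =
      signed ((j + 1) * (m + snd r + sum_list (map snd ps)))
        (y * cartan_diff (m + snd r) (\<lambda>ts. F (r # ts)) (ps @ [(z, l)]))
      + cartan_diff (m + snd r) (\<lambda>ts. F (r # ts)) (ps @ [(y, j)]) * z"
      using Cons.IH[of "m + snd r" "\<lambda>ts. F (r # ts)"] derivation_Cons[OF Cons.prems(1) h(1)]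
        slot_additive_Cons[OF Cons.prems(2)] graded_map_Cons[OF Cons.prems(3) h(1)] Cons.prems(5,6) h(2)
      by simp
    have 2: "Lie r m F (ps @ [(y * z, j + l + 1)]) =
      signed ((j + 1) * (m + snd r + sum_list (map snd ps))) (y * Lie r m F (ps @ [(z, l)]))
      + Lie r m F (ps @ [(y, j)]) * z"
      using derivation_Lie[OF Cons.prems(1-3) h(1)] Cons.prems(5,6) h(2)
      by (simp add: derivation_def)
    have e: "m + sum_list (map snd (r # ps)) = m + snd r + sum_list (map snd ps)" by simp
    define k where "k = (j + 1) * (m + snd r + sum_list (map snd ps))"
    show ?case
      unfolding e append_Cons cartan_diff.simps(2) 1 2 k_def[symmetric] by (simp add: signed_def algebra_simps)
  qed
  then show ?thesis using assms by (simp add: derivation_def)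
qed

section \<open>The recursion agrees with the explicit sums\<close>

lemma nths_Cons_Compl_0: "nths (x # xs) (- {0}) = xs"
  and nths_Cons_Compl_Suc: "nths (x # xs) (- {Suc i}) = x # nths xs (- {i})"
  and nths_Cons_Compl_0_Suc: "nths (x # xs) (- {0, Suc j}) = nths xs (- {j})"
  and nths_Cons_Compl_Suc_Suc: "nths (x # xs) (- {Suc i, Suc j}) = x # nths xs (- {i, j})"
proof -
  have "{j. Suc j \<in> - {0}} = UNIV" "{j. Suc j \<in> - {Suc i}} = - {i}"
    "{k. Suc k \<in> - {0, Suc j}} = - {j}" "{k. Suc k \<in> - {Suc i, Suc j}} = - {i, j}" by auto
  then show "nths (x # xs) (- {0}) = xs" "nths (x # xs) (- {Suc i}) = x # nths xs (- {i})"
    "nths (x # xs) (- {0, Suc j}) = nths xs (- {j})"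
    "nths (x # xs) (- {Suc i, Suc j}) = x # nths xs (- {i, j})"
    by (simp_all add: nths_Cons nths_all)
qed

lemma list_all_nths: "list_all P xs \<Longrightarrow> list_all P (nths xs A)"
  by (auto simp: list_all_iff dest: in_set_nthsD)

text \<open>
  Each bracket is moved to the front; inductively, a bracket that is already at the front of the
  remaining arguments has to be swapped with one further argument.
\<close>

lemma Lie_explicit:
  assumes "antisymmetric F" "hom_pair p" "list_all hom_pair qs"
  shows "Lie p m F qs = br (fst p) (F qs) -
    (\<Sum>j<length qs. signed (snd p * m + int j + snd (qs ! j) * (\<Sum>i<j. snd (qs ! i)))
       (F (pair_br p (qs ! j) # nths qs (- {j}))))"
  using assms(1,3)
proof (induction qs arbitrary: m F)
  case (Cons q qs)
  have h: "hom_pair q" "list_all hom_pair qs" using Cons.prems by auto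
  have sw: "F (q # pair_br p (qs ! j) # nths qs (- {j})) =
      signed (snd q * (snd p + snd (qs ! j)) + 1) (F (pair_br p (qs ! j) # q # nths qs (- {j})))"
    if "j < length qs" for j
  proof -
    have "hom_pair (qs ! j)" using h(2) that by (simp add: list_all_length)
    then show ?thesis
      using antisymmetric_swap[OF Cons.prems(1), of q "pair_br p (qs ! j)" "nths qs (- {j})"] h assms(2)
      by (simp add: hom_pair_pair_br list_all_nths)
  qed
  have "Lie p (m + snd q) (\<lambda>ts. F (q # ts)) qs = br (fst p) (F (q # qs)) -
    (\<Sum>j<length qs. signed (snd p * (m + snd q) + int j + snd (qs ! j) * (\<Sum>i<j. snd (qs ! i)))
       (F (q # pair_br p (qs ! j) # nths qs (- {j}))))"
    using Cons.IH antisymmetric_Cons[OF Cons.prems(1)] h by blast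
  also have "(\<Sum>j<length qs. signed (snd p * (m + snd q) + int j + snd (qs ! j) * (\<Sum>i<j. snd (qs ! i)))
       (F (q # pair_br p (qs ! j) # nths qs (- {j})))) =
    (\<Sum>j<length qs. signed (snd p * m + int (Suc j) + snd (qs ! j) * (snd q + (\<Sum>i<j. snd (qs ! i))))
       (F (pair_br p (qs ! j) # q # nths qs (- {j}))))"
    by (intro sum.cong refl) (simp add: sw signed_signed, auto simp: signed_def)
  finally show ?case
    by (simp add: sum.lessThan_Suc_shift nths_Cons_Compl_0 nths_Cons_Compl_Suc del: sum.lessThan_Suc)
qed simp

text \<open>
  In the sums for \<open>x # qs\<close>, the terms in which \<open>x\<close> is bracketed form the Lie derivative along \<open>x\<close>; the others
  are the sums for \<open>\<iota>\<^sub>x F\<close> on \<open>qs\<close>, up to one swap of \<open>x\<close> with the bracket \<open>[q\<^sub>i, q\<^sub>j]\<close>.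
\<close>

lemma cartan_diff_explicit:
  assumes "antisymmetric F" "list_all hom_pair qs"
  shows "cartan_diff m F qs =
    (\<Sum>i<length qs. signed (int i + snd (qs ! i) * (m + (\<Sum>p<i. snd (qs ! p))))
       (br (fst (qs ! i)) (F (nths qs (- {i}))))) +
    (\<Sum>j<length qs. \<Sum>i<j. signed (int i + int j + snd (qs ! i) * (\<Sum>p<i. snd (qs ! p))
          + snd (qs ! j) * (\<Sum>q\<in>{..<j} - {i}. snd (qs ! q)))
       (F (pair_br (qs ! i) (qs ! j) # nths qs (- {i, j}))))"
  using assms
proof (induction qs arbitrary: m F)
  case (Cons x qs)
  have h: "hom_pair x" "list_all hom_pair qs" using Cons.prems by auto
  let ?x = "snd x" and ?d = "\<lambda>i. snd (qs ! i)"
  let ?s = "\<lambda>j. \<Sum>i<j. snd (qs ! i)" and ?t = "\<lambda>i j. \<Sum>q\<in>{..<j} - {i}. snd (qs ! q)"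
  have sw: "F (x # pair_br (qs ! i) (qs ! j) # nths qs (- {i, j})) =
      signed (?x * (?d i + ?d j) + 1) (F (pair_br (qs ! i) (qs ! j) # x # nths qs (- {i, j})))"
    if "i < length qs" "j < length qs" for i j
  proof -
    have "hom_pair (qs ! i)" "hom_pair (qs ! j)" using h(2) that by (simp_all add: list_all_length)
    then show ?thesis
      using antisymmetric_swap[OF Cons.prems(1), of x "pair_br (qs ! i) (qs ! j)" "nths qs (- {i, j})"] h
      by (simp add: hom_pair_pair_br list_all_nths)
  qed
  have t0: "{..<Suc j} - {0} = Suc ` {..<j}" for j
    by (auto simp: image_iff Bex_def) presburger
  have tS: "(\<Sum>q\<in>{..<Suc j} - {Suc i}. snd ((x # qs) ! q)) = ?x + ?t i j" for i j
  proof -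
    have "{..<Suc j} - {Suc i} = insert 0 (Suc ` ({..<j} - {i}))"
      by (auto simp: image_iff Bex_def) presburger
    then show ?thesis by (simp add: sum.reindex)
  qed
  have 1: "signed (?x * m) (Lie x m F qs) = signed (?x * m) (br (fst x) (F qs)) +
      (\<Sum>j<length qs. signed (int (Suc j) + ?d j * ?s j) (F (pair_br x (qs ! j) # nths qs (- {j}))))"
    unfolding Lie_explicit[OF Cons.prems(1) h] signed_diff signed_sum signed_signed
    unfolding diff_conv_add_uminus sum_negf[symmetric]
    by (intro arg_cong2[where f = "(+)"] sum.cong refl) (auto simp: signed_def)
  have "cartan_diff (m + ?x) (\<lambda>ts. F (x # ts)) qs =
    (\<Sum>i<length qs. signed (int i + ?d i * (m + ?x + ?s i)) (br (fst (qs ! i)) (F (x # nths qs (- {i}))))) +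
    (\<Sum>j<length qs. \<Sum>i<j. signed (int i + int j + ?d i * ?s i + ?d j * ?t i j)
       (F (x # pair_br (qs ! i) (qs ! j) # nths qs (- {i, j}))))"
    using Cons.IH antisymmetric_Cons[OF Cons.prems(1)] h by blast
  also have "(\<Sum>i<length qs. signed (int i + ?d i * (m + ?x + ?s i)) (br (fst (qs ! i)) (F (x # nths qs (- {i}))))) =
    - (\<Sum>i<length qs. signed (int (Suc i) + ?d i * (m + (?x + ?s i))) (br (fst (qs ! i)) (F (x # nths qs (- {i})))))"
      (is "_ = - ?X")
    unfolding sum_negf[symmetric] by (intro sum.cong refl) (auto simp: signed_def)
  also have "(\<Sum>j<length qs. \<Sum>i<j. signed (int i + int j + ?d i * ?s i + ?d j * ?t i j)
       (F (x # pair_br (qs ! i) (qs ! j) # nths qs (- {i, j})))) =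
    - (\<Sum>j<length qs. \<Sum>i<j. signed (int (Suc i) + int (Suc j) + ?d i * (?x + ?s i) + ?d j * (?x + ?t i j))
       (F (pair_br (qs ! i) (qs ! j) # x # nths qs (- {i, j}))))"
      (is "_ = - ?Y")
    unfolding sum_negf[symmetric]
    by (intro sum.cong refl) (simp add: sw signed_signed, auto simp: signed_def)
  finally have 2: "cartan_diff (m + ?x) (\<lambda>ts. F (x # ts)) qs = - ?X + - ?Y" .
  show ?case
    unfolding cartan_diff.simps(2) 1 2
    by (simp add: sum.lessThan_Suc_shift nths_Cons_Compl_0 nths_Cons_Compl_Suc nths_Cons_Compl_0_Suc
      nths_Cons_Compl_Suc_Suc t0 tS sum.reindex sum.distrib algebra_simps del: sum.lessThan_Suc)
qed simp

section \<open>Multilinear extension\<close>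

abbreviation lin :: "('a \<Rightarrow> 'a) \<Rightarrow> bool" where
  "lin \<equiv> Vector_Spaces.linear scale scale"

lemma lin_iff: "lin g \<longleftrightarrow> (\<forall>x y. g (x + y) = g x + g y) \<and> (\<forall>c x. g (scale c x) = scale c (g x))"
  using vector_space_axioms by (simp add: Vector_Spaces.linear_iff)

lemma lin_zero: "lin (\<lambda>x. 0)"
  by (simp add: lin_iff)

lemma lin_add: "lin g \<Longrightarrow> lin h \<Longrightarrow> lin (\<lambda>x. g x + h x)"
  by (simp add: lin_iff scale_right_distrib)

lemma lin_scale: "lin g \<Longrightarrow> lin (\<lambda>x. scale c (g x))"
  by (simp add: lin_iff scale_right_distrib scale_left_commute)

lemma lin_sum: "(\<And>i. i \<in> A \<Longrightarrow> lin (g i)) \<Longrightarrow> lin (\<lambda>x. \<Sum>i\<in>A. g i x)"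
  by (induction A rule: infinite_finite_induct) (simp_all add: lin_zero lin_add)

lemma lin_compose: "lin h \<Longrightarrow> lin g \<Longrightarrow> lin (\<lambda>x. h (g x))"
  by (simp add: lin_iff)

lemma multilinear_lin:
  assumes "multilinear scale n f" "i < length xs"
  shows "lin (\<lambda>x. f (xs[i := x]))"
proof (cases "length xs = n")
  case True
  then show ?thesis using assms by (simp add: multilinear_def)
next
  case False
  then have "(\<lambda>x. f (xs[i := x])) = (\<lambda>x. 0)" using assms by (auto simp: multilinear_def)
  then show ?thesis by (simp only: lin_zero)
qed

lemma nths_update_notin: "k \<notin> A \<Longrightarrow> nths (xs[k := x]) A = nths xs A"
  by (induction xs arbitrary: k A) (auto simp: nths_Cons split: nat.split)

lemma nths_update_in:
  assumes "k < length xs" "k \<in> A"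
  shows "\<exists>k'<length (nths xs A). \<forall>x. nths (xs[k := x]) A = (nths xs A)[k' := x]"
  using assms
proof (induction xs arbitrary: k A)
  case (Cons y ys)
  show ?case
  proof (cases k)
    case 0
    then show ?thesis using Cons.prems by (intro exI[of _ 0]) (simp add: nths_Cons)
  next
    case (Suc l)
    then obtain k' where k': "k' < length (nths ys {j. Suc j \<in> A})"
      "\<And>x. nths (ys[l := x]) {j. Suc j \<in> A} = (nths ys {j. Suc j \<in> A})[k' := x]"
      using Cons.IH[of l "{j. Suc j \<in> A}"] Cons.prems by auto
    show ?thesis
      by (rule exI[of _ "if 0 \<in> A then Suc k' else k'"]) (use k' Suc in \<open>simp add: nths_Cons\<close>)
  qed
qed simp

text \<open>
  Each summand contains the argument in slot \<open>k\<close> exactly once: in one of the brackets, or, if \<open>k\<close> is not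
  an omitted index, in one slot of \<open>f\<close>.
\<close>

lemma lin_diff_hom:
  assumes f: "multilinear scale n f" and xs: "length xs = n + 1" and k: "k < n + 1"
  shows "lin (\<lambda>x. diff_hom scale br n m f ds (xs[k := x]))"
  unfolding diff_hom_def
proof (intro lin_add lin_sum lin_scale)
  fix i assume i: "i \<in> {..n}"
  show "lin (\<lambda>x. br (xs[k := x] ! i) (f (nths (xs[k := x]) (- {i}))))"
  proof (cases "k = i")
    case True
    then show ?thesis using linear_br_left xs k by (simp add: nths_update_notin)
  next
    case False
    then obtain k' where "k' < length (nths xs (- {i}))"
      "\<And>x. nths (xs[k := x]) (- {i}) = (nths xs (- {i}))[k' := x]"
      using nths_update_in[of k xs "- {i}"] k xs by auto
    then show ?thesis
      using False lin_compose[OF linear_br_right multilinear_lin[OF f]] by simp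
  qed
next
  fix i j assume ij: "j \<in> {..n}" "i \<in> {..<j}"
  let ?g = "\<lambda>x. f (br (xs[k := x] ! i) (xs[k := x] ! j) # nths (xs[k := x]) (- {i, j}))"
  have first: "lin (\<lambda>y. f (y # nths xs (- {i, j})))"
    using multilinear_lin[OF f, of 0 "undefined # nths xs (- {i, j})"] by simp
  consider "k = i" | "k = j" | "k \<noteq> i" "k \<noteq> j" by blast
  then show "lin ?g"
  proof cases
    case 1
    then have "?g = (\<lambda>x. f (br x (xs ! j) # nths xs (- {i, j})))"
      using ij k xs by (auto simp: nths_update_notin)
    then show ?thesis using lin_compose[OF first linear_br_left] by simp
  next
    case 2
    then have "?g = (\<lambda>x. f (br (xs ! i) x # nths xs (- {i, j})))"
      using ij k xs by (auto simp: nths_update_notin)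
    then show ?thesis using lin_compose[OF first linear_br_right] by simp
  next
    case 3
    then obtain k' where k': "k' < length (nths xs (- {i, j}))"
      "\<And>x. nths (xs[k := x]) (- {i, j}) = (nths xs (- {i, j}))[k' := x]"
      using nths_update_in[of k xs "- {i, j}"] k xs by auto
    then have "?g = (\<lambda>x. f ((br (xs ! i) (xs ! j) # nths xs (- {i, j}))[Suc k' := x]))"
      using 3 by simp
    then show ?thesis using multilinear_lin[OF f, of "Suc k'" "br (xs ! i) (xs ! j) # nths xs (- {i, j})"] k' by simp
  qed
qed

lemma component_decomposition: "is_decomposition gr x (component gr x)"
  unfolding component_def using direct_sum_gr[of x] by (rule theI')

lemma component_in_gr: "component gr x i \<in> gr i"
  and finite_component: "finite {i. component gr x i \<noteq> 0}"
  using component_decomposition[of x] by (auto simp: is_decomposition_def)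

lemma is_decomposition_add:
  assumes "is_decomposition A x c" "is_decomposition A y d" "\<And>i a b. a \<in> A i \<Longrightarrow> b \<in> A i \<Longrightarrow> a + b \<in> A i"
  shows "is_decomposition A (x + y) (\<lambda>i. c i + d i)"
proof -
  let ?S = "{i. c i \<noteq> 0} \<union> {i. d i \<noteq> 0}"
  have fin: "finite ?S" using assms by (simp add: is_decomposition_def)
  have "x = sum c ?S" "y = sum d ?S"
    using assms(1,2) fin by (auto simp: is_decomposition_def intro!: sum.mono_neutral_left)
  then show ?thesis using assms fin
    by (intro is_decompositionI[where S = ?S]) (auto simp: is_decomposition_def sum.distrib)
qed

lemma is_decomposition_map:
  assumes c: "is_decomposition A x c" and h: "\<And>a b. h (a + b) = h a + h b" "h 0 = 0"
    and "\<And>i a. a \<in> A i \<Longrightarrow> h a \<in> B i"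
  shows "is_decomposition B (h x) (\<lambda>i. h (c i))"
proof -
  let ?S = "{i. c i \<noteq> 0}"
  have "h (sum c S) = (\<Sum>i\<in>S. h (c i))" for S
    by (induction S rule: infinite_finite_induct) (simp_all add: h)
  then show ?thesis using assms
    by (intro is_decompositionI[where S = ?S]) (auto simp: is_decomposition_def)
qed

lemma component_add: "component gr (x + y) i = component gr x i + component gr y i"
  using component_gr_eqI[OF is_decomposition_add[OF component_decomposition component_decomposition gr_add], of x y]
  by simp

lemma component_scale: "component gr (scale c x) i = scale c (component gr x i)"
proof -
  have "scale c a \<in> gr i" if "a \<in> gr i" for a i
    using subspace_gr subspace_scale that by blast
  then show ?thesis
    using component_gr_eqI[OF is_decomposition_map[OF component_decomposition, of "scale c" gr x]]
    by (simp add: scale_right_distrib)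
qed

lemma in_listset_iff: "ds \<in> listset As \<longleftrightarrow> list_all2 (\<in>) ds As"
  by (induction As arbitrary: ds) (auto simp: set_Cons_def list_all2_Cons2)

definition slotwise_linear :: "nat \<Rightarrow> (int list \<Rightarrow> 'a list \<Rightarrow> 'a) \<Rightarrow> bool" where
  "slotwise_linear n F \<longleftrightarrow>
     (\<forall>ds xs k. length xs = n \<longrightarrow> k < n \<longrightarrow> lin (\<lambda>x. F ds (xs[k := x])))"

lemma slotwise_linear_zero:
  assumes "slotwise_linear n F" "length xs = n" "0 \<in> set xs"
  shows "F ds xs = 0"
proof -
  obtain k where k: "k < n" "xs ! k = 0" using assms by (auto simp: in_set_conv_nth)
  interpret l: Vector_Spaces.linear scale scale "\<lambda>x. F ds (xs[k := x])"
    using assms k by (simp add: slotwise_linear_def)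
  show ?thesis using l.zero k by (metis list_update_id)
qed

text \<open>
  The index set of the defining sum depends on the arguments.  Additivity becomes visible once it is
  replaced by a larger set that can be shared by several argument lists; the extra summands vanish
  because they contain a zero argument.
\<close>

lemma multilinear_extension_eq_sum:
  assumes F: "slotwise_linear n F" and xs: "length xs = n" and S: "finite S"
    and sub: "\<And>x i. x \<in> set xs \<Longrightarrow> component gr x i \<noteq> 0 \<Longrightarrow> i \<in> S"
  shows "multilinear_extension gr n F xs =
    (\<Sum>ds\<in>{ds. set ds \<subseteq> S \<and> length ds = n}. F ds (map2 (component gr) xs ds))"
proof -
  let ?L = "listset (map (\<lambda>x. {i. component gr x i \<noteq> 0}) xs)"
  have L: "ds \<in> ?L \<longleftrightarrow> length ds = n \<and> (\<forall>i<n. component gr (xs ! i) (ds ! i) \<noteq> 0)" for ds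
    using xs by (auto simp: in_listset_iff list_all2_conv_all_nth)
  have "(\<Sum>ds\<in>?L. F ds (map2 (component gr) xs ds)) =
      (\<Sum>ds\<in>{ds. set ds \<subseteq> S \<and> length ds = n}. F ds (map2 (component gr) xs ds))"
  proof (rule sum.mono_neutral_left)
    show "finite {ds. set ds \<subseteq> S \<and> length ds = n}" using S by (rule finite_lists_length_eq)
    show "?L \<subseteq> {ds. set ds \<subseteq> S \<and> length ds = n}"
    proof
      fix ds assume ds: "ds \<in> ?L"
      have "e \<in> S" if "e \<in> set ds" for e
        using that ds xs sub[of "xs ! i" "ds ! i" for i] nth_mem[of _ xs]
        unfolding L in_set_conv_nth[of e] by metis
      then show "ds \<in> {ds. set ds \<subseteq> S \<and> length ds = n}" using ds L by auto
    qed
    show "\<forall>ds\<in>{ds. set ds \<subseteq> S \<and> length ds = n} - ?L. F ds (map2 (component gr) xs ds) = 0"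
    proof
      fix ds assume ds: "ds \<in> {ds. set ds \<subseteq> S \<and> length ds = n} - ?L"
      then obtain i where "i < n" "component gr (xs ! i) (ds ! i) = 0" by (auto simp: L)
      then have "0 \<in> set (map2 (component gr) xs ds)"
        using ds xs nth_mem[of i "map2 (component gr) xs ds"] by simp
      then show "F ds (map2 (component gr) xs ds) = 0"
        using slotwise_linear_zero[OF F] ds xs by simp
    qed
  qed
  then show ?thesis using xs by (simp add: multilinear_extension_def)
qed

lemma multilinear_multilinear_extension:
  assumes F: "slotwise_linear n F"
  shows "multilinear scale n (multilinear_extension gr n F)"
proof -
  have "lin (\<lambda>x. multilinear_extension gr n F (xs[k := x]))" if xs: "length xs = n" "k < n" for xs k
  proof -
    let ?S = "\<lambda>T. \<Union>x\<in>T. {i. component gr x i \<noteq> 0}"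
    define E where "E S x = (\<Sum>ds\<in>{ds. set ds \<subseteq> S \<and> length ds = n}. F ds (map2 (component gr) (xs[k := x]) ds))" for S x
    have eq: "multilinear_extension gr n F (xs[k := x]) = E (?S (T \<union> set xs)) x"
      if "finite T" "x \<in> T" for T x
      using that xs set_update_subset_insert[of xs k x]
      unfolding E_def by (intro multilinear_extension_eq_sum[OF F]) (auto simp: finite_component)
    have linE: "lin (E S)" for S
      unfolding E_def
    proof (rule lin_sum)
      fix ds assume "ds \<in> {ds. set ds \<subseteq> S \<and> length ds = n}"
      then have ds: "length ds = n" by simp
      have upd: "map2 (component gr) (xs[k := x]) ds = (map2 (component gr) xs ds)[k := component gr x (ds ! k)]" for x
        using xs ds by (intro nth_equalityI) (auto simp: nth_list_update)
      have c: "lin (\<lambda>x. component gr x (ds ! k))"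
        by (simp add: lin_iff component_add component_scale)
      have l: "lin (\<lambda>y. F ds ((map2 (component gr) xs ds)[k := y]))"
        using F xs ds by (simp add: slotwise_linear_def)
      show "lin (\<lambda>x. F ds (map2 (component gr) (xs[k := x]) ds))"
        unfolding upd by (rule lin_compose[OF l c])
    qed
    show ?thesis
      unfolding lin_iff
    proof (intro conjI allI)
      fix x y c
      show "multilinear_extension gr n F (xs[k := x + y]) =
          multilinear_extension gr n F (xs[k := x]) + multilinear_extension gr n F (xs[k := y])"
        using linE[of "?S ({x, y, x + y} \<union> set xs)"] eq[of "{x, y, x + y}"]
        unfolding lin_iff by (simp only: finite.intros insert_iff simp_thms)
      show "multilinear_extension gr n F (xs[k := scale c x]) =
          scale c (multilinear_extension gr n F (xs[k := x]))"
        using linE[of "?S ({x, scale c x} \<union> set xs)"] eq[of "{x, scale c x}"]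
        unfolding lin_iff by (simp only: finite.intros insert_iff simp_thms)
    qed
  qed
  then show ?thesis by (simp add: multilinear_def multilinear_extension_def)
qed

lemma multilinear_extension_homogeneous:
  assumes F: "slotwise_linear n F" and xs: "length xs = n" "homogeneous_list gr xs ds"
  shows "multilinear_extension gr n F xs = F ds xs"
proof -
  have ds: "length ds = n" "\<And>i. i < n \<Longrightarrow> xs ! i \<in> gr (ds ! i)"
    using xs by (auto simp: homogeneous_list_def list_all2_conv_all_nth)
  have comp: "component gr (xs ! i) j = (if j = ds ! i then xs ! i else 0)" if "i < n" for i j
    using component_gr_hom[OF ds(2)[OF that]] by simp
  have "multilinear_extension gr n F xs =
    (\<Sum>es\<in>{es. set es \<subseteq> set ds \<and> length es = n}. F es (map2 (component gr) xs es))"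
    by (rule multilinear_extension_eq_sum[OF F xs(1)])
      (use xs(1) ds(1) comp in \<open>auto simp: in_set_conv_nth split: if_splits\<close>)
  also have "\<dots> = (\<Sum>es\<in>{ds}. F es (map2 (component gr) xs es))"
  proof (rule sum.mono_neutral_right)
    show "\<forall>es\<in>{es. set es \<subseteq> set ds \<and> length es = n} - {ds}. F es (map2 (component gr) xs es) = 0"
    proof
      fix es assume es: "es \<in> {es. set es \<subseteq> set ds \<and> length es = n} - {ds}"
      then obtain i where "i < n" "es ! i \<noteq> ds ! i"
        using ds(1) nth_equalityI[of es ds] by auto
      then have "0 \<in> set (map2 (component gr) xs es)"
        using es xs(1) comp[of i "es ! i"] nth_mem[of i "map2 (component gr) xs es"] by simp
      then show "F es (map2 (component gr) xs es) = 0"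
        using slotwise_linear_zero[OF F] es xs by simp
    qed
  qed (use ds(1) in \<open>auto simp: finite_lists_length_eq\<close>)
  also have "\<dots> = F ds (map2 (component gr) xs ds)" by simp
  also have "map2 (component gr) xs ds = xs"
    using xs(1) ds(1) comp by (intro nth_equalityI) auto
  finally show ?thesis .
qed

section \<open>Homogeneous forms and their differential\<close>

definition pairs :: "'a list \<Rightarrow> int list \<Rightarrow> ('a \<times> int) list" where
  "pairs xs ds = zip xs (map (\<lambda>d. d - 1) ds)"

definition on_pairs :: "('a list \<Rightarrow> 'a) \<Rightarrow> ('a \<times> int) list \<Rightarrow> 'a" where
  "on_pairs f ps = f (map fst ps)"

lemma length_pairs: "length xs = length ds \<Longrightarrow> length (pairs xs ds) = length xs"
  by (simp add: pairs_def)

lemma map_fst_pairs: "length xs = length ds \<Longrightarrow> map fst (pairs xs ds) = xs"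
  by (simp add: pairs_def)

lemma nth_pairs: "length xs = length ds \<Longrightarrow> i < length xs \<Longrightarrow> pairs xs ds ! i = (xs ! i, ds ! i - 1)"
  by (simp add: pairs_def)

lemma homogeneous_list_length: "homogeneous_list gr xs ds \<Longrightarrow> length xs = length ds"
  by (auto simp: homogeneous_list_def dest: list_all2_lengthD)

lemma list_all_pairs: "homogeneous_list gr xs ds \<Longrightarrow> list_all hom_pair (pairs xs ds)"
  by (auto simp: homogeneous_list_def list_all2_conv_all_nth list_all_length pairs_def hom_pair_def)

lemma sum_list_minus_one: "sum_list (map (\<lambda>d. d - 1) ds) = sum_list ds - int (length ds)"
  by (induction ds) auto

lemma sum_list_pairs:
  "length xs = length ds \<Longrightarrow> sum_list (map snd (pairs xs ds)) = sum_list ds - int (length xs)"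
  by (simp add: pairs_def sum_list_minus_one)

lemma pairs_surj:
  assumes "list_all hom_pair ps"
  obtains xs ds where "ps = pairs xs ds" "homogeneous_list gr xs ds"
proof
  show "ps = pairs (map fst ps) (map (\<lambda>p. snd p + 1) ps)"
    by (induction ps) (simp_all add: pairs_def)
  show "homogeneous_list gr (map fst ps) (map (\<lambda>p. snd p + 1) ps)"
    using assms by (simp add: homogeneous_list_def list_all2_conv_all_nth list_all_length hom_pair_def)
qed

lemma pairs_append:
  "length xs = length ds \<Longrightarrow> pairs (xs @ ys) (ds @ es) = pairs xs ds @ pairs ys es"
  by (simp add: pairs_def)

lemma split_adjacent:
  assumes "Suc i < length zs"
  shows "zs = take i zs @ zs ! i # zs ! Suc i # drop (Suc (Suc i)) zs"
    and "zs[i := a, Suc i := b] = take i zs @ a # b # drop (Suc (Suc i)) zs"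
  using assms
  by (simp_all add: Cons_nth_drop_Suc upd_conv_take_nth_drop drop_update_swap take_update_swap nth_append)

lemma antisymmetric_iff:
  "antisymmetric F \<longleftrightarrow> (\<forall>zs i. list_all hom_pair zs \<longrightarrow> Suc i < length zs \<longrightarrow>
     F zs = - signed (snd (zs ! i) * snd (zs ! Suc i)) (F (zs[i := zs ! Suc i, Suc i := zs ! i])))"
proof
  assume F: "antisymmetric F"
  show "\<forall>zs i. list_all hom_pair zs \<longrightarrow> Suc i < length zs \<longrightarrow>
     F zs = - signed (snd (zs ! i) * snd (zs ! Suc i)) (F (zs[i := zs ! Suc i, Suc i := zs ! i]))"
  proof (intro allI impI)
    fix zs i assume zs: "list_all hom_pair zs" "Suc i < length zs"
    have "list_all hom_pair (take i zs @ zs ! i # zs ! Suc i # drop (Suc (Suc i)) zs)"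
      using zs(1) split_adjacent(1)[OF zs(2)] by simp
    then show "F zs = - signed (snd (zs ! i) * snd (zs ! Suc i)) (F (zs[i := zs ! Suc i, Suc i := zs ! i]))"
      using F split_adjacent(1)[OF zs(2)]
        split_adjacent(2)[OF zs(2), where a = "zs ! Suc i" and b = "zs ! i"] unfolding antisymmetric_def by metis
  qed
next
  assume F: "\<forall>zs i. list_all hom_pair zs \<longrightarrow> Suc i < length zs \<longrightarrow>
     F zs = - signed (snd (zs ! i) * snd (zs ! Suc i)) (F (zs[i := zs ! Suc i, Suc i := zs ! i]))"
  show "antisymmetric F"
    unfolding antisymmetric_def
  proof (intro allI impI)
    fix ps p q qs assume "list_all hom_pair (ps @ p # q # qs)"
    then show "F (ps @ p # q # qs) = - signed (snd p * snd q) (F (ps @ q # p # qs))"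
      using F[rule_format, of "ps @ p # q # qs" "length ps"] by (simp add: nth_append list_update_append)
  qed
qed

lemma pairs_swap:
  assumes "length xs = length ds" "Suc i < length xs"
  shows "(pairs xs ds)[i := pairs xs ds ! Suc i, Suc i := pairs xs ds ! i] =
    pairs (xs[i := xs ! Suc i, Suc i := xs ! i]) (ds[i := ds ! Suc i, Suc i := ds ! i])"
  using assms by (simp add: pairs_def zip_update map_update)

lemma homogeneous_list_swap:
  assumes "homogeneous_list gr xs ds" "Suc i < length xs"
  shows "homogeneous_list gr (xs[i := xs ! Suc i, Suc i := xs ! i]) (ds[i := ds ! Suc i, Suc i := ds ! i])"
  using assms by (auto simp: homogeneous_list_def list_all2_conv_all_nth nth_list_update)

text \<open>
  This and the next two lemmas translate the conditions on an \<open>n\<close>-form into the arity-free ones and back.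
  A map \<open>F\<close> on pairs is only compared with \<open>f\<close> on homogeneous lists of length \<open>n\<close>; to obtain the
  arity-free condition, \<open>F\<close> also has to vanish on the other lengths.
\<close>

lemma graded_antisymmetric_transfer:
  assumes F: "\<And>xs ds. length xs = n \<Longrightarrow> homogeneous_list gr xs ds \<Longrightarrow> F (pairs xs ds) = f xs"
  shows "antisymmetric F \<Longrightarrow> graded_antisymmetric scale gr n f"
    and "graded_antisymmetric scale gr n f \<Longrightarrow> (\<And>ps. length ps \<noteq> n \<Longrightarrow> F ps = 0) \<Longrightarrow> antisymmetric F"
proof -
  have *: "(f xs = - scale ((-1) powi ((ds ! i - 1) * (ds ! Suc i - 1))) (f (xs[i := xs ! Suc i, Suc i := xs ! i])))
     \<longleftrightarrow> (let zs = pairs xs ds in F zs = - signed (snd (zs ! i) * snd (zs ! Suc i))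
           (F (zs[i := zs ! Suc i, Suc i := zs ! i])))"
    if "length xs = n" "homogeneous_list gr xs ds" "Suc i < n" for xs ds i
  proof -
    have len: "length xs = length ds" using that(2) by (rule homogeneous_list_length)
    have sw: "F ((pairs xs ds)[i := pairs xs ds ! Suc i, Suc i := pairs xs ds ! i]) =
        f (xs[i := xs ! Suc i, Suc i := xs ! i])"
      using that len homogeneous_list_swap[OF that(2), of i] by (simp only: pairs_swap) (simp add: F)
    show ?thesis
      unfolding Let_def sw F[OF that(1,2)] scale_minus_one_powi
      using that len by (simp add: nth_pairs)
  qed
  {
    assume a: "graded_antisymmetric scale gr n f" and F0: "\<And>ps. length ps \<noteq> n \<Longrightarrow> F ps = 0"
    show "antisymmetric F"
      unfolding antisymmetric_iff
    proof (intro allI impI)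
      fix zs :: "('a \<times> int) list" and i
      assume zs: "list_all hom_pair zs" "Suc i < length zs"
      then obtain xs ds where x: "zs = pairs xs ds" "homogeneous_list gr xs ds"
        using pairs_surj by blast
      have len: "length zs = length xs" using x length_pairs homogeneous_list_length by blast
      show "F zs = - signed (snd (zs ! i) * snd (zs ! Suc i)) (F (zs[i := zs ! Suc i, Suc i := zs ! i]))"
      proof (cases "length zs = n")
        case True
        then show ?thesis
          using a[unfolded graded_antisymmetric_def, rule_format, of xs ds i] *[of xs ds i] x len zs
          unfolding Let_def by metis
      next
        case False
        then show ?thesis by (simp add: F0 signed_zero)
      qed
    qed
  }
  {
    assume a: "antisymmetric F"
    show "graded_antisymmetric scale gr n f"
      unfolding graded_antisymmetric_def
    proof (intro allI impI)
      fix xs ds i assume x: "length xs = n" "homogeneous_list gr xs ds" "Suc i < n"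
      show "f xs = - scale ((-1) powi ((ds ! i - 1) * (ds ! Suc i - 1))) (f (xs[i := xs ! Suc i, Suc i := xs ! i]))"
        using a[unfolded antisymmetric_iff, rule_format, OF list_all_pairs[OF x(2)], of i] x
          length_pairs[OF homogeneous_list_length[OF x(2)]]
        unfolding *[OF x] Let_def by simp
    qed
  }
qed

lemma derivation_last_transfer:
  assumes n: "n \<ge> 1" and M: "M = m + int n - 1"
    and F: "\<And>xs ds. length xs = n \<Longrightarrow> homogeneous_list gr xs ds \<Longrightarrow> F (pairs xs ds) = f xs"
  shows "derivation M F \<Longrightarrow> derivation_last scale gr n m f"
    and "derivation_last scale gr n m f \<Longrightarrow> (\<And>ps. length ps \<noteq> n \<Longrightarrow> F ps = 0) \<Longrightarrow> derivation M F"
proof -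
  have ap: "F (pairs xs ds @ [(w, e - 1)]) = f (xs @ [w])"
    if "length xs = n - 1" "homogeneous_list gr xs ds" "w \<in> gr e" for xs ds w e
  proof -
    have "homogeneous_list gr (xs @ [w]) (ds @ [e])"
      using that by (simp add: homogeneous_list_def list_all2_appendI)
    then show ?thesis
      using F[of "xs @ [w]" "ds @ [e]"] that n homogeneous_list_length[OF that(2)]
      by (simp add: pairs_append) (simp add: pairs_def)
  qed
  have *: "(f (xs @ [y * z]) =
          scale ((-1) powi (j * (m + sum_list ds))) (y * f (xs @ [z])) + f (xs @ [y]) * z) \<longleftrightarrow>
      (F (pairs xs ds @ [(y * z, (j - 1) + (l - 1) + 1)]) =
          signed ((j - 1 + 1) * (M + sum_list (map snd (pairs xs ds)))) (y * F (pairs xs ds @ [(z, l - 1)]))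
          + F (pairs xs ds @ [(y, j - 1)]) * z)"
    if x: "length xs = n - 1" "homogeneous_list gr xs ds" "y \<in> gr j" "z \<in> gr l" for xs ds y j z l
  proof -
    have s: "M + sum_list (map snd (pairs xs ds)) = m + sum_list ds"
      using homogeneous_list_length[OF x(2)] x(1) n by (simp add: sum_list_pairs M)
    show ?thesis
      using ap[OF x(1,2) mult_gr[OF x(3,4)]] ap[OF x(1-3)] ap[OF x(1,2,4)]
      unfolding s scale_minus_one_powi by (simp add: algebra_simps)
  qed
  {
    assume a: "derivation_last scale gr n m f" and F0: "\<And>ps. length ps \<noteq> n \<Longrightarrow> F ps = 0"
    show "derivation M F"
      unfolding derivation_def
    proof (intro allI impI)
      fix ps y j z l assume ps: "list_all hom_pair ps" "y \<in> gr (j + 1)" "z \<in> gr (l + 1)"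
      then obtain xs ds where x: "ps = pairs xs ds" "homogeneous_list gr xs ds"
        using pairs_surj by blast
      have len: "length ps = length xs" using x length_pairs homogeneous_list_length by blast
      show "F (ps @ [(y * z, j + l + 1)]) =
          signed ((j + 1) * (M + sum_list (map snd ps))) (y * F (ps @ [(z, l)])) + F (ps @ [(y, j)]) * z"
      proof (cases "length ps = n - 1")
        case True
        then show ?thesis
          using a[unfolded derivation_last_def, rule_format, of xs ds y "j + 1" z "l + 1"]
            *[of xs ds y "j + 1" z "l + 1"] x len ps by simp
      next
        case False
        then show ?thesis using n by (simp add: F0 signed_zero)
      qed
    qed
  }
  {
    assume a: "derivation M F"
    show "derivation_last scale gr n m f"
      unfolding derivation_last_def
    proof (intro allI impI)
      fix xs ds y j z l
      assume x: "length xs = n - 1" "homogeneous_list gr xs ds" "y \<in> gr j" "z \<in> gr l"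
      show "f (xs @ [y * z]) =
          scale ((-1) powi (j * (m + sum_list ds))) (y * f (xs @ [z])) + f (xs @ [y]) * z"
        unfolding *[OF x]
        using a[unfolded derivation_def, rule_format, OF list_all_pairs[OF x(2)], of y "j - 1" z "l - 1"] x
        by simp
    qed
  }
qed

lemma homogeneous_map_transfer:
  assumes M: "M = m + int n - 1"
    and F: "\<And>xs ds. length xs = n \<Longrightarrow> homogeneous_list gr xs ds \<Longrightarrow> F (pairs xs ds) = f xs"
  shows "graded_map M F \<Longrightarrow> homogeneous_map gr n m f"
    and "homogeneous_map gr n m f \<Longrightarrow> (\<And>ps. length ps \<noteq> n \<Longrightarrow> F ps = 0) \<Longrightarrow> graded_map M F"
proof -
  have s: "M + sum_list (map snd (pairs xs ds)) + 1 = m + sum_list ds"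
    if "length xs = n" "homogeneous_list gr xs ds" for xs ds
    using homogeneous_list_length[OF that(2)] that(1) by (simp add: sum_list_pairs M)
  {
    assume a: "homogeneous_map gr n m f" and F0: "\<And>ps. length ps \<noteq> n \<Longrightarrow> F ps = 0"
    show "graded_map M F"
      unfolding graded_map_def
    proof (intro allI impI)
      fix ps assume "list_all hom_pair ps"
      then obtain xs ds where x: "ps = pairs xs ds" "homogeneous_list gr xs ds"
        using pairs_surj by blast
      have len: "length ps = length xs" using x length_pairs homogeneous_list_length by blast
      show "F ps \<in> gr (M + sum_list (map snd ps) + 1)"
      proof (cases "length ps = n")
        case True
        then show ?thesis using a x len s[of xs ds] F[of xs ds] by (simp add: homogeneous_map_def)
      next
        case False
        then show ?thesis by (simp add: F0 gr_zero)
      qed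
    qed
  }
  {
    assume a: "graded_map M F"
    show "homogeneous_map gr n m f"
      unfolding homogeneous_map_def
    proof (intro allI impI)
      fix xs ds assume x: "length xs = n" "homogeneous_list gr xs ds"
      show "f xs \<in> gr (m + sum_list ds)"
        using a[unfolded graded_map_def, rule_format, OF list_all_pairs[OF x(2)]] x
        by (simp only: s F)
    qed
  }
qed

lemma on_pairs_pairs: "homogeneous_list gr xs ds \<Longrightarrow> on_pairs f (pairs xs ds) = f xs"
  by (simp add: on_pairs_def map_fst_pairs homogeneous_list_length)

lemma on_pairs_other_length: "multilinear scale n f \<Longrightarrow> length ps \<noteq> n \<Longrightarrow> on_pairs f ps = 0"
  by (simp add: on_pairs_def multilinear_def)

lemma slot_additive_on_pairs:
  assumes "multilinear scale n f"
  shows "slot_additive (on_pairs f)"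
  unfolding slot_additive_def on_pairs_def
proof (intro allI)
  fix ps :: "('a \<times> int) list" and a b d qs
  show "f (map fst (ps @ (a + b, d) # qs)) = f (map fst (ps @ (a, d) # qs)) + f (map fst (ps @ (b, d) # qs))"
    using multilinear_lin[OF assms, of "length ps" "map fst ps @ undefined # map fst qs"]
    by (simp add: lin_iff list_update_append)
qed

lemma hom_forms_on_pairs:
  assumes "n \<ge> 1" "f \<in> hom_forms scale gr n m"
  shows "slot_additive (on_pairs f)" "graded_map (m + int n - 1) (on_pairs f)"
    "antisymmetric (on_pairs f)" "derivation (m + int n - 1) (on_pairs f)"
proof -
  have f: "multilinear scale n f" "homogeneous_map gr n m f" "graded_antisymmetric scale gr n f"
    "derivation_last scale gr n m f"
    using assms(2) by (auto simp: hom_forms_def)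
  show "slot_additive (on_pairs f)" by (rule slot_additive_on_pairs[OF f(1)])
  note F = on_pairs_pairs on_pairs_other_length[OF f(1)]
  show "graded_map (m + int n - 1) (on_pairs f)"
    by (rule homogeneous_map_transfer(2)[OF refl F(1) f(2) F(2)])
  show "antisymmetric (on_pairs f)"
    by (rule graded_antisymmetric_transfer(2)[OF F(1) f(3) F(2)])
  show "derivation (m + int n - 1) (on_pairs f)"
    by (rule derivation_last_transfer(2)[OF assms(1) refl F(1) f(4) F(2)])
qed

lemma diff_hom_eq_cartan_diff:
  assumes n: "n \<ge> 1" and f: "f \<in> hom_forms scale gr n m"
    and xs: "length xs = n + 1" "homogeneous_list gr xs ds"
  shows "diff_hom scale br n m f ds xs = cartan_diff (m + int n - 1) (on_pairs f) (pairs xs ds)"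
proof -
  have len: "length xs = length ds" using xs(2) by (rule homogeneous_list_length)
  have nths: "on_pairs f (nths (pairs xs ds) A) = f (nths xs A)" for A
    by (simp add: on_pairs_def map_fst_pairs[OF len] flip: nths_map)
  have nths': "on_pairs f (p # nths (pairs xs ds) A) = f (fst p # nths xs A)" for p A
    by (simp add: on_pairs_def map_fst_pairs[OF len] flip: nths_map)
  have snds: "(\<Sum>p\<in>A. snd (pairs xs ds ! p)) = (\<Sum>p\<in>A. ds ! p - 1)" if "A \<subseteq> {..n}" for A
    using that len xs(1) by (intro sum.cong refl) (auto simp: nth_pairs subset_iff)
  show ?thesis
    unfolding cartan_diff_explicit[OF hom_forms_on_pairs(3)[OF n f] list_all_pairs[OF xs(2)]] diff_hom_def
      scale_minus_one_powi length_pairs[OF len] xs(1) add_Suc_right add_0_right One_nat_def lessThan_Suc_atMost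
  proof (intro arg_cong2[where f = "(+)"] sum.cong refl)
    fix i assume "i \<in> {..n}"
    then show "signed (int i + (ds ! i - 1) * (m + int n - 1 + (\<Sum>p<i. ds ! p - 1))) (br (xs ! i) (f (nths xs (- {i})))) =
      signed (int i + snd (pairs xs ds ! i) * (m + int n - 1 + (\<Sum>p<i. snd (pairs xs ds ! p))))
        (br (fst (pairs xs ds ! i)) (on_pairs f (nths (pairs xs ds) (- {i}))))"
      using len xs(1) snds[of "{..<i}"] by (simp add: nths nth_pairs subset_iff)
  next
    fix j i assume "j \<in> {..n}" "i \<in> {..<j}"
    then show "signed (int i + int j + (ds ! i - 1) * (\<Sum>p<i. ds ! p - 1) + (ds ! j - 1) * (\<Sum>q\<in>{..<j} - {i}. ds ! q - 1))
        (f (br (xs ! i) (xs ! j) # nths xs (- {i, j}))) =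
      signed (int i + int j + snd (pairs xs ds ! i) * (\<Sum>p<i. snd (pairs xs ds ! p))
          + snd (pairs xs ds ! j) * (\<Sum>q\<in>{..<j} - {i}. snd (pairs xs ds ! q)))
        (on_pairs f (pair_br (pairs xs ds ! i) (pairs xs ds ! j) # nths (pairs xs ds) (- {i, j})))"
      using len xs(1) snds[of "{..<i}"] snds[of "{..<j} - {i}"]
      by (simp add: nths' nth_pairs subset_iff)
  qed
qed

text \<open>
  The differential on forms known to be homogeneous of degree \<open>m\<close>.  Its arity \<open>n\<close> and degree \<open>m\<close> are
  parameters, since the zero form does not determine them.
\<close>

definition hom_diff :: "nat \<Rightarrow> int \<Rightarrow> ('a list \<Rightarrow> 'a) \<Rightarrow> 'a list \<Rightarrow> 'a" where
  "hom_diff n m f = multilinear_extension gr (n + 1) (diff_hom scale br n m f)"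

lemma slotwise_linear_diff_hom:
  "f \<in> hom_forms scale gr n m \<Longrightarrow> slotwise_linear (n + 1) (diff_hom scale br n m f)"
  by (simp add: slotwise_linear_def hom_forms_def lin_diff_hom)

lemma multilinear_hom_diff:
  "f \<in> hom_forms scale gr n m \<Longrightarrow> multilinear scale (n + 1) (hom_diff n m f)"
  unfolding hom_diff_def by (intro multilinear_multilinear_extension slotwise_linear_diff_hom)

lemma hom_diff_eq_cartan_diff:
  assumes "n \<ge> 1" "f \<in> hom_forms scale gr n m" "length xs = n + 1" "homogeneous_list gr xs ds"
  shows "hom_diff n m f xs = cartan_diff (m + int n - 1) (on_pairs f) (pairs xs ds)"
  unfolding hom_diff_def multilinear_extension_homogeneous[OF slotwise_linear_diff_hom[OF assms(2)] assms(3,4)]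
  by (rule diff_hom_eq_cartan_diff[OF assms])

lemma hom_diff_in_hom_forms:
  assumes n: "n \<ge> 1" and f: "f \<in> hom_forms scale gr n m"
  shows "hom_diff n m f \<in> hom_forms scale gr (n + 1) (m - 1)"
proof -
  let ?D = "cartan_diff (m + int n - 1) (on_pairs f)"
  note F = hom_forms_on_pairs[OF n f]
  note D = hom_diff_eq_cartan_diff[OF n f, symmetric]
  have deg: "m + int n - 1 = m - 1 + int (n + 1) - 1" and n': "n + 1 \<ge> 1" by simp_all
  have "homogeneous_map gr (n + 1) (m - 1) (hom_diff n m f)"
    by (rule homogeneous_map_transfer(1)[OF deg D graded_map_cartan_diff[OF F(2)]])
  moreover have "graded_antisymmetric scale gr (n + 1) (hom_diff n m f)"
    by (rule graded_antisymmetric_transfer(1)[OF D antisymmetric_cartan_diff[OF F(3,1)]])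
  moreover have "derivation_last scale gr (n + 1) (m - 1) (hom_diff n m f)"
    by (rule derivation_last_transfer(1)[OF n' deg D derivation_cartan_diff[OF F(4,1,2)]])
  ultimately show ?thesis using multilinear_hom_diff[OF f] by (simp add: hom_forms_def)
qed

lemma multilinear_zero: "multilinear scale n 0"
  using zero_in_hom_forms[of n] by (simp add: hom_forms_def)

lemma hom_diff_hom_diff:
  assumes n: "n \<ge> 1" and f: "f \<in> hom_forms scale gr n m"
  shows "hom_diff (n + 1) (m - 1) (hom_diff n m f) = 0"
proof (rule multilinear_eqI)
  have df: "hom_diff n m f \<in> hom_forms scale gr (n + 1) (m - 1)"
    by (rule hom_diff_in_hom_forms[OF n f])
  show "multilinear scale (n + 1 + 1) (hom_diff (n + 1) (m - 1) (hom_diff n m f))"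
    by (rule multilinear_hom_diff[OF df])
  show "multilinear scale (n + 1 + 1) 0" by (rule multilinear_zero)
  fix xs ds assume xs: "length xs = n + 1 + 1" "homogeneous_list gr xs ds"
  let ?D = "cartan_diff (m + int n - 1)"
  have "hom_diff (n + 1) (m - 1) (hom_diff n m f) xs = ?D (on_pairs (hom_diff n m f)) (pairs xs ds)"
    using hom_diff_eq_cartan_diff[OF _ df xs] by simp
  also have "\<dots> = ?D (?D (on_pairs f)) (pairs xs ds)"
  proof (rule cartan_diff_cong[OF _ list_all_pairs[OF xs(2)]])
    fix ts assume ts: "list_all hom_pair ts" "Suc (length ts) = length (pairs xs ds)"
    then obtain ys es where y: "ts = pairs ys es" "homogeneous_list gr ys es" using pairs_surj by blast
    have "length ys = n + 1"
      using ts(2) y xs length_pairs homogeneous_list_length by fastforce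
    then show "on_pairs (hom_diff n m f) ts = ?D (on_pairs f) ts"
      using hom_diff_eq_cartan_diff[OF n f _ y(2)] y by (simp add: on_pairs_pairs)
  qed
  also have "\<dots> = 0"
    by (rule cartan_diff_cartan_diff[OF hom_forms_on_pairs(1,2)[OF n f] list_all_pairs[OF xs(2)]])
  finally show "hom_diff (n + 1) (m - 1) (hom_diff n m f) xs = 0 xs" by simp
qed

lemma hom_diff_add: "hom_diff n m (f + g) = hom_diff n m f + hom_diff n m g"
  by (auto simp: hom_diff_def multilinear_extension_def diff_hom_def br_add_right scale_right_distrib
      sum.distrib fun_eq_iff)

lemma hom_diff_scale: "hom_diff n m (map_scale scale c f) = map_scale scale c (hom_diff n m f)"
  by (auto simp: hom_diff_def multilinear_extension_def diff_hom_def map_scale_def br_scale_right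
      scale_right_distrib scale_sum_right scale_left_commute fun_eq_iff intro!: arg_cong2[where f = "(+)"] sum.cong)

lemma hom_diff_zero: "hom_diff n m 0 = 0"
  by (auto simp: hom_diff_def multilinear_extension_def diff_hom_def br_zero_right fun_eq_iff)

section \<open>General forms\<close>

lemma vector_space_map_scale: "vector_space (map_scale scale :: 'k \<Rightarrow> ('a list \<Rightarrow> 'a) \<Rightarrow> _)"
  by unfold_locales (simp_all add: map_scale_def fun_eq_iff scale_right_distrib scale_left_distrib)

sublocale forms: vector_space "map_scale scale :: 'k \<Rightarrow> ('a list \<Rightarrow> 'a) \<Rightarrow> _"
  by (rule vector_space_map_scale)

lemma gr_scale: "x \<in> gr i \<Longrightarrow> scale c x \<in> gr i"
  using subspace_gr subspace_scale by blast

lemma scale_signed: "scale c (signed k x) = signed k (scale c x)"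
  by (simp add: signed_def)

lemma subspace_hom_forms: "forms.subspace (hom_forms scale gr n m)"
proof (rule forms.subspaceI)
  show "0 \<in> hom_forms scale gr n m" by (rule zero_in_hom_forms)
next
  fix f g assume fg: "f \<in> hom_forms scale gr n m" "g \<in> hom_forms scale gr n m"
  show "f + g \<in> hom_forms scale gr n m"
    unfolding hom_forms_def
  proof (intro CollectI conjI)
    show "multilinear scale n (f + g)"
      using fg by (simp add: hom_forms_def multilinear_def lin_add)
    show "homogeneous_map gr n m (f + g)"
      using fg by (simp add: hom_forms_def homogeneous_map_def gr_add)
    show "graded_antisymmetric scale gr n (f + g)"
      unfolding graded_antisymmetric_def
    proof (intro allI impI)
      fix xs ds i assume x: "length xs = n" "homogeneous_list gr xs ds" "Suc i < n"
      have "h xs = - scale ((-1) powi ((ds ! i - 1) * (ds ! Suc i - 1))) (h (xs[i := xs ! Suc i, Suc i := xs ! i]))"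
        if "h \<in> hom_forms scale gr n m" for h
        using that x unfolding hom_forms_def graded_antisymmetric_def by blast
      from this[OF fg(1)] this[OF fg(2)]
      show "(f + g) xs = - scale ((-1) powi ((ds ! i - 1) * (ds ! Suc i - 1)))
          ((f + g) (xs[i := xs ! Suc i, Suc i := xs ! i]))"
        by (simp add: scale_right_distrib)
    qed
    show "derivation_last scale gr n m (f + g)"
      using fg by (auto simp: hom_forms_def derivation_last_def scale_right_distrib algebra_simps)
  qed
next
  fix c f assume f: "f \<in> hom_forms scale gr n m"
  show "map_scale scale c f \<in> hom_forms scale gr n m"
    unfolding hom_forms_def
  proof (intro CollectI conjI)
    show "multilinear scale n (map_scale scale c f)"
      using f by (simp add: hom_forms_def multilinear_def map_scale_def lin_scale)
    show "homogeneous_map gr n m (map_scale scale c f)"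
      using f by (simp add: hom_forms_def homogeneous_map_def map_scale_def gr_scale)
    show "graded_antisymmetric scale gr n (map_scale scale c f)"
      unfolding graded_antisymmetric_def
    proof (intro allI impI)
      fix xs ds i assume x: "length xs = n" "homogeneous_list gr xs ds" "Suc i < n"
      have e: "f xs = - scale ((-1) powi ((ds ! i - 1) * (ds ! Suc i - 1))) (f (xs[i := xs ! Suc i, Suc i := xs ! i]))"
        using f x unfolding hom_forms_def graded_antisymmetric_def by blast
      show "map_scale scale c f xs = - scale ((-1) powi ((ds ! i - 1) * (ds ! Suc i - 1)))
          (map_scale scale c f (xs[i := xs ! Suc i, Suc i := xs ! i]))"
        unfolding map_scale_def by (subst e) (simp only: scale_minus_one_powi scale_signed scale_minus_right)
    qed
    show "derivation_last scale gr n m (map_scale scale c f)"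
      using f by (auto simp: hom_forms_def derivation_last_def map_scale_def scale_right_distrib mult.commute
          simp flip: scale_mult_right scale_mult_left)
  qed
qed

lemma hom_forms_add: "f \<in> hom_forms scale gr n m \<Longrightarrow> g \<in> hom_forms scale gr n m \<Longrightarrow> f + g \<in> hom_forms scale gr n m"
  using subspace_hom_forms forms.subspace_add by blast

lemma hom_forms_scale: "f \<in> hom_forms scale gr n m \<Longrightarrow> map_scale scale c f \<in> hom_forms scale gr n m"
  using subspace_hom_forms forms.subspace_scale by blast

lemma hom_forms_subset_big: "n \<ge> 1 \<Longrightarrow> hom_forms scale gr n m \<subseteq> big_forms scale gr n"
  using forms.span_superset[of "\<Union>m. hom_forms scale gr n m"] by (auto simp: big_forms_def)

lemma const_form_add: "const_form (g + h) = const_form g + const_form h"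
  and const_form_scale: "const_form (scale c g) = map_scale scale c (const_form g)"
  and const_form_zero: "const_form 0 = 0"
  by (auto simp: const_form_def map_scale_def fun_eq_iff)

lemma subspace_const_forms:
  assumes "subspace V"
  shows "forms.subspace (const_form ` V)"
proof (rule forms.subspaceI)
  show "0 \<in> const_form ` V"
    using const_form_zero subspace_0[OF assms] by (metis imageI)
  show "f + g \<in> const_form ` V" if "f \<in> const_form ` V" "g \<in> const_form ` V" for f g
    using that subspace_add[OF assms] by (auto simp flip: const_form_add)
  show "map_scale scale c f \<in> const_form ` V" if "f \<in> const_form ` V" for c f
    using that subspace_scale[OF assms] by (auto simp flip: const_form_scale)
qed

lemma subspace_big_forms: "forms.subspace (big_forms scale gr n)"
  using subspace_const_forms[OF subspace_UNIV] by (simp add: big_forms_def forms.subspace_span)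

lemma is_decomposition_single:
  assumes "x \<in> A i" "\<And>j. 0 \<in> A j"
  shows "is_decomposition A x (\<lambda>j. if j = i then x else 0)"
  by (rule is_decompositionI[where S = "{i}"]) (use assms in auto)

text \<open>
  Members of the span are exactly the forms to which the definition of the differential by
  homogeneous components applies.
\<close>

lemma big_forms_iff:
  assumes "n \<ge> 1"
  shows "f \<in> big_forms scale gr n \<longleftrightarrow> (\<exists>c. is_decomposition (hom_forms scale gr n) f c)"
proof
  assume "f \<in> big_forms scale gr n"
  then have "f \<in> forms.span (\<Union>m. hom_forms scale gr n m)" using assms by (simp add: big_forms_def)
  then show "\<exists>c. is_decomposition (hom_forms scale gr n) f c"
  proof (induction rule: forms.span_induct_alt)
    case base
    then show ?case
      using is_decomposition_single[of 0 "hom_forms scale gr n", OF zero_in_hom_forms zero_in_hom_forms] by blast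
  next
    case (step a g h)
    then obtain m c where g: "g \<in> hom_forms scale gr n m"
      and c: "is_decomposition (hom_forms scale gr n) h c" by blast
    have "is_decomposition (hom_forms scale gr n) (map_scale scale a g)
        (\<lambda>j. if j = m then map_scale scale a g else 0)"
      by (intro is_decomposition_single hom_forms_scale g zero_in_hom_forms)
    from is_decomposition_add[OF this c hom_forms_add] show ?case by blast
  qed
next
  assume "\<exists>c. is_decomposition (hom_forms scale gr n) f c"
  then obtain c where c: "is_decomposition (hom_forms scale gr n) f c" by blast
  show "f \<in> big_forms scale gr n"
    using c hom_forms_subset_big[OF assms] unfolding is_decomposition_def
    by (auto intro!: forms.subspace_sum subspace_big_forms)
qed

lemma diff_eq_sum:
  assumes "n \<ge> 1" "is_decomposition (hom_forms scale gr n) f c" "finite S" "\<And>m. m \<notin> S \<Longrightarrow> c m = 0"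
  shows "diff scale gr br n f = (\<Sum>m\<in>S. hom_diff n m (c m))"
proof -
  have "component (hom_forms scale gr n) f = c"
    unfolding component_def using assms(2) hom_forms_decomposition_unique by blast
  then have "diff scale gr br n f = (\<Sum>m\<in>{m. c m \<noteq> 0}. hom_diff n m (c m))"
    using assms(1) by (simp add: diff_def Let_def hom_diff_def)
  also have "\<dots> = (\<Sum>m\<in>S. hom_diff n m (c m))"
    by (rule sum.mono_neutral_left) (use assms(3,4) in \<open>auto simp: hom_diff_zero\<close>)
  finally show ?thesis .
qed

lemma diff_decomposition:
  assumes n: "n \<ge> 1" and c: "is_decomposition (hom_forms scale gr n) f c"
  shows "is_decomposition (hom_forms scale gr (n + 1)) (diff scale gr br n f) (\<lambda>m. hom_diff n (m + 1) (c (m + 1)))"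
proof (rule is_decompositionI[where S = "(\<lambda>m. m - 1) ` {m. c m \<noteq> 0}"])
  show "hom_diff n (i + 1) (c (i + 1)) \<in> hom_forms scale gr (n + 1) i" for i
    using hom_diff_in_hom_forms[OF n, of "c (i + 1)" "i + 1"] c by (simp add: is_decomposition_def)
  show "finite ((\<lambda>m. m - 1) ` {m. c m \<noteq> 0})" using c by (simp add: is_decomposition_def)
  show "hom_diff n (i + 1) (c (i + 1)) = 0" if "i \<notin> (\<lambda>m. m - 1) ` {m. c m \<noteq> 0}" for i
  proof -
    have "c (i + 1) = 0" using that by force
    then show ?thesis by (simp add: hom_diff_zero)
  qed
  have "diff scale gr br n f = (\<Sum>m\<in>{m. c m \<noteq> 0}. hom_diff n m (c m))"
    by (rule diff_eq_sum[OF n c]) (use c in \<open>auto simp: is_decomposition_def\<close>)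
  then show "diff scale gr br n f = (\<Sum>m\<in>(\<lambda>m. m - 1) ` {m. c m \<noteq> 0}. hom_diff n (m + 1) (c (m + 1)))"
    by (simp add: sum.reindex inj_on_def)
qed

lemma diff_hom_form:
  assumes "n \<ge> 1" "f \<in> hom_forms scale gr n m"
  shows "diff scale gr br n f = hom_diff n m f"
  using diff_eq_sum[OF assms(1) is_decomposition_single[of f "hom_forms scale gr n" m, OF assms(2) zero_in_hom_forms], of "{m}"]
  by simp

section \<open>The differential of elements of the algebra\<close>

definition ad :: "'a \<Rightarrow> 'a list \<Rightarrow> 'a" where
  "ad g xs = (if length xs = 1 then br g (hd xs) else 0)"

lemma diff_const_form: "diff scale gr br 0 (const_form g) = ad g"
  by (auto simp: diff_def ad_def const_form_def fun_eq_iff)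

lemma ad_add: "ad (g + h) = ad g + ad h"
  and ad_scale: "ad (scale c g) = map_scale scale c (ad g)"
  and ad_zero: "ad 0 = 0"
  by (auto simp: ad_def map_scale_def br_add_left br_scale_left br_zero_left fun_eq_iff)

lemma slot_additive_const: "slot_additive (\<lambda>ps. if ps = [] then g else 0)"
  by (simp add: slot_additive_def)

lemma cartan_diff_const:
  assumes "g \<in> gr m" "hom_pair p"
  shows "cartan_diff (m - 1) (\<lambda>ps. if ps = [] then g else 0) [p] = - br g (fst p)"
  using br_antisym_shifted[of "fst p" "snd p" g "m - 1"] assms
  by (simp add: hom_pair_def signed_minus signed_signed) (simp add: signed_def)

lemma ad_in_hom_forms:
  assumes g: "g \<in> gr m"
  shows "ad g \<in> hom_forms scale gr 1 (m - 1)"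
  unfolding hom_forms_def
proof (intro CollectI conjI)
  show "multilinear scale 1 (ad g)"
    using linear_br_right by (auto simp: multilinear_def ad_def length_Suc_conv)
  show "homogeneous_map gr 1 (m - 1) (ad g)"
    using br_gr[OF g] by (auto simp: homogeneous_map_def homogeneous_list_def ad_def length_Suc_conv
        list_all2_Cons1 algebra_simps)
  show "graded_antisymmetric scale gr 1 (ad g)"
    by (simp add: graded_antisymmetric_def)
  show "derivation_last scale gr 1 (m - 1) (ad g)"
    using br_leibniz[OF g] by (auto simp: derivation_last_def homogeneous_list_def ad_def)
qed

text \<open>
  On the map without arguments with value \<open>g\<close> the recursion gives \<open>- ad g\<close> (\<open>cartan_diff_const\<close>), so that
  this is an instance of \<open>cartan_diff_cartan_diff\<close>.
\<close>

lemma hom_diff_ad: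
  assumes g: "g \<in> gr m"
  shows "hom_diff 1 (m - 1) (ad g) = 0"
proof (rule multilinear_eqI)
  have ad: "ad g \<in> hom_forms scale gr 1 (m - 1)" by (rule ad_in_hom_forms[OF g])
  show "multilinear scale (1 + 1) (hom_diff 1 (m - 1) (ad g))" by (rule multilinear_hom_diff[OF ad])
  show "multilinear scale (1 + 1) 0" by (rule multilinear_zero)
  fix xs ds assume xs: "length xs = 1 + 1" "homogeneous_list gr xs ds"
  let ?D = "cartan_diff (m - 1)" and ?G = "\<lambda>ps. if ps = [] then g else 0"
  have "hom_diff 1 (m - 1) (ad g) xs = ?D (on_pairs (ad g)) (pairs xs ds)"
    using hom_diff_eq_cartan_diff[OF _ ad xs] by simp
  also have "\<dots> = ?D (\<lambda>ps. signed 1 (?D ?G ps)) (pairs xs ds)"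
  proof (rule cartan_diff_cong[OF _ list_all_pairs[OF xs(2)]])
    fix ts assume ts: "list_all hom_pair ts" "Suc (length ts) = length (pairs xs ds)"
    then have "length ts = 1" using xs length_pairs homogeneous_list_length by fastforce
    then obtain p where "ts = [p]" by (auto simp: length_Suc_conv)
    then show "on_pairs (ad g) ts = signed 1 (?D ?G ts)"
      using cartan_diff_const[OF g, of p] ts(1) by (simp add: on_pairs_def ad_def signed_def del: cartan_diff.simps)
  qed
  also have "\<dots> = signed 1 (?D (?D ?G) (pairs xs ds))" by (rule cartan_diff_signed)
  also have "?D (?D ?G) (pairs xs ds) = 0"
    by (rule cartan_diff_cartan_diff[OF slot_additive_const _ list_all_pairs[OF xs(2)]])
      (use g gr_zero in \<open>auto simp: graded_map_def\<close>)
  finally show "hom_diff 1 (m - 1) (ad g) xs = 0 xs" by (simp add: signed_zero)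
qed

lemma ad_decomposition:
  "is_decomposition (hom_forms scale gr 1) (ad g) (\<lambda>m. ad (component gr g (m + 1)))"
proof -
  have "is_decomposition (\<lambda>m. hom_forms scale gr 1 (m - 1)) (ad g) (\<lambda>m. ad (component gr g m))"
    by (rule is_decomposition_map[where h = ad, OF component_decomposition ad_add ad_zero ad_in_hom_forms])
  then have c: "\<And>m. ad (component gr g m) \<in> hom_forms scale gr 1 (m - 1)"
    "finite {m. ad (component gr g m) \<noteq> 0}" "ad g = (\<Sum>m\<in>{m. ad (component gr g m) \<noteq> 0}. ad (component gr g m))"
    by (auto simp: is_decomposition_def)
  show ?thesis
  proof (rule is_decompositionI[where S = "(\<lambda>m. m - 1) ` {m. ad (component gr g m) \<noteq> 0}"])
    show "ad (component gr g (i + 1)) \<in> hom_forms scale gr 1 i" for i using c(1)[of "i + 1"] by simp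
    show "ad (component gr g (i + 1)) = 0" if "i \<notin> (\<lambda>m. m - 1) ` {m. ad (component gr g m) \<noteq> 0}" for i
      using that by force
    show "finite ((\<lambda>m. m - 1) ` {m. ad (component gr g m) \<noteq> 0})" using c(2) by simp
    show "ad g = (\<Sum>m\<in>(\<lambda>m. m - 1) ` {m. ad (component gr g m) \<noteq> 0}. ad (component gr g (m + 1)))"
      using c(3) by (simp add: sum.reindex inj_on_def)
  qed
qed

section \<open>The big and the small complex\<close>

lemma diff_in_big_forms:
  assumes "f \<in> big_forms scale gr n"
  shows "diff scale gr br n f \<in> big_forms scale gr (n + 1)"
proof (cases "n = 0")
  case True
  then obtain g where "f = const_form g" using assms by (auto simp: big_forms_def)
  then show ?thesis
    using True ad_decomposition[of g] big_forms_iff[of 1] by (auto simp: diff_const_form)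
next
  case False
  then have n: "n \<ge> 1" by simp
  then obtain c where "is_decomposition (hom_forms scale gr n) f c" using assms big_forms_iff by blast
  then show ?thesis using diff_decomposition[OF n] big_forms_iff[of "n + 1"] by auto
qed

lemma diff_diff:
  assumes "f \<in> big_forms scale gr n"
  shows "diff scale gr br (n + 1) (diff scale gr br n f) = 0"
proof (cases "n = 0")
  case True
  then obtain g where g: "f = const_form g" using assms by (auto simp: big_forms_def)
  have "diff scale gr br 1 (ad g) = (\<Sum>m\<in>{m. ad (component gr g (m + 1)) \<noteq> 0}. hom_diff 1 m (ad (component gr g (m + 1))))"
    by (rule diff_eq_sum[OF _ ad_decomposition])
      (use ad_decomposition[of g] in \<open>auto simp: is_decomposition_def\<close>)
  also have "\<dots> = 0"
    using hom_diff_ad[OF component_in_gr[of g "m + 1" for m]] by (simp add: sum.neutral)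
  finally show ?thesis using True g by (simp add: diff_const_form)
next
  case False
  then have n: "n \<ge> 1" by simp
  then obtain c where c: "is_decomposition (hom_forms scale gr n) f c" using assms big_forms_iff by blast
  let ?c = "\<lambda>m. hom_diff n (m + 1) (c (m + 1))"
  have "diff scale gr br (n + 1) (diff scale gr br n f) = (\<Sum>m\<in>{m. ?c m \<noteq> 0}. hom_diff (n + 1) m (?c m))"
    by (rule diff_eq_sum[OF _ diff_decomposition[OF n c]])
      (use diff_decomposition[OF n c] in \<open>auto simp: is_decomposition_def\<close>)
  also have "\<dots> = 0"
  proof (rule sum.neutral, rule ballI)
    fix m
    have "c (m + 1) \<in> hom_forms scale gr n (m + 1)" using c by (simp add: is_decomposition_def)
    from hom_diff_hom_diff[OF n this] show "hom_diff (n + 1) m (?c m) = 0" by simp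
  qed
  finally show ?thesis .
qed

lemma diff_add:
  assumes "f \<in> big_forms scale gr n" "g \<in> big_forms scale gr n"
  shows "diff scale gr br n (f + g) = diff scale gr br n f + diff scale gr br n g"
proof (cases "n = 0")
  case True
  then show ?thesis using assms by (auto simp: big_forms_def diff_const_form ad_add simp flip: const_form_add)
next
  case False
  then have n: "n \<ge> 1" by simp
  obtain b c where b: "is_decomposition (hom_forms scale gr n) f b"
    and c: "is_decomposition (hom_forms scale gr n) g c"
    using assms big_forms_iff[OF n] by blast
  let ?S = "{m. b m \<noteq> 0} \<union> {m. c m \<noteq> 0}"
  have S: "finite ?S" using b c by (simp add: is_decomposition_def)
  have "diff scale gr br n (f + g) = (\<Sum>m\<in>?S. hom_diff n m (b m + c m))"
    by (rule diff_eq_sum[OF n is_decomposition_add[OF b c hom_forms_add] S]) auto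
  also have "\<dots> = (\<Sum>m\<in>?S. hom_diff n m (b m)) + (\<Sum>m\<in>?S. hom_diff n m (c m))"
    by (simp add: hom_diff_add sum.distrib)
  also have "\<dots> = diff scale gr br n f + diff scale gr br n g"
    using diff_eq_sum[OF n b S] diff_eq_sum[OF n c S] by simp
  finally show ?thesis .
qed

lemma diff_map_scale:
  assumes "f \<in> big_forms scale gr n"
  shows "diff scale gr br n (map_scale scale a f) = map_scale scale a (diff scale gr br n f)"
proof (cases "n = 0")
  case True
  then show ?thesis using assms by (auto simp: big_forms_def diff_const_form ad_scale simp flip: const_form_scale)
next
  case False
  then have n: "n \<ge> 1" by simp
  obtain c where c: "is_decomposition (hom_forms scale gr n) f c"
    using assms big_forms_iff[OF n] by blast
  let ?S = "{m. c m \<noteq> 0}"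
  have S: "finite ?S" using c by (simp add: is_decomposition_def)
  have "is_decomposition (hom_forms scale gr n) (map_scale scale a f) (\<lambda>m. map_scale scale a (c m))"
    by (rule is_decomposition_map[where h = "map_scale scale a",
          OF c forms.scale_right_distrib forms.scale_zero_right hom_forms_scale])
  then have "diff scale gr br n (map_scale scale a f) = (\<Sum>m\<in>?S. hom_diff n m (map_scale scale a (c m)))"
    by (rule diff_eq_sum[OF n _ S]) auto
  also have "\<dots> = map_scale scale a (\<Sum>m\<in>?S. hom_diff n m (c m))"
    by (simp add: hom_diff_scale forms.scale_sum_right)
  also have "\<dots> = map_scale scale a (diff scale gr br n f)"
    by (subst diff_eq_sum[OF n c S]) auto
  finally show ?thesis .
qed

text \<open>
  A value \<open>f xs\<close> on homogeneous arguments has at most one nonzero component, and its components are the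
  values of the homogeneous components of \<open>f\<close>; so all these but one vanish on homogeneous arguments.
\<close>

lemma small_forms_eq_hom_forms:
  assumes n: "n \<ge> 1"
  shows "small_forms scale gr n = hom_forms scale gr n (- int n)"
proof
  show "hom_forms scale gr n (- int n) \<subseteq> small_forms scale gr n"
    using n hom_forms_subset_big[OF n] by (auto simp: small_forms_def hom_forms_def)
  show "small_forms scale gr n \<subseteq> hom_forms scale gr n (- int n)"
  proof
    fix f assume "f \<in> small_forms scale gr n"
    then have f: "f \<in> big_forms scale gr n" "homogeneous_map gr n (- int n) f"
      using n by (auto simp: small_forms_def)
    obtain c where c: "is_decomposition (hom_forms scale gr n) f c"
      using f(1) big_forms_iff[OF n] by blast
    have cm: "c m \<in> hom_forms scale gr n m" for m using c by (simp add: is_decomposition_def)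
    have "c m = 0" if m: "m \<noteq> - int n" for m
    proof (rule multilinear_eqI)
      show "multilinear scale n (c m)" using cm[of m] by (simp add: hom_forms_def)
      show "multilinear scale n 0" by (rule multilinear_zero)
      fix xs ds assume xs: "length xs = n" "homogeneous_list gr xs ds"
      have comp: "component gr (c k xs) i = (if i = k + sum_list ds then c k xs else 0)" for k i
        using component_gr_hom[of "c k xs" "k + sum_list ds"] cm[of k] xs
        by (simp add: hom_forms_def homogeneous_map_def)
      have comp_sum: "component gr (\<Sum>k\<in>S. h k) i = (\<Sum>k\<in>S. component gr (h k) i)"
        if "finite S" for S and h :: "int \<Rightarrow> 'a" and i
        using that component_gr_hom[OF gr_zero, of 0] by induction (simp_all add: component_add)
      have app: "(\<Sum>k\<in>S. c k) xs = (\<Sum>k\<in>S. c k xs)" for S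
        by (induction S rule: infinite_finite_induct) auto
      have "f xs = (\<Sum>k\<in>{k. c k \<noteq> 0}. c k xs)"
        using c by (simp add: is_decomposition_def flip: app)
      then have "component gr (f xs) (m + sum_list ds) = (\<Sum>k\<in>{k. c k \<noteq> 0}. if k = m then c k xs else 0)"
        using c by (simp add: comp_sum comp is_decomposition_def)
      also have "\<dots> = c m xs" using c by (auto simp: is_decomposition_def)
      finally have "c m xs = component gr (f xs) (m + sum_list ds)" by simp
      also have "\<dots> = 0"
        using f(2) xs m component_gr_hom[of "f xs" "- int n + sum_list ds"] by (simp add: homogeneous_map_def)
      finally show "c m xs = 0 xs" by simp
    qed
    then have "sum c {m. c m \<noteq> 0} = sum c {- int n}"
      by (intro sum.mono_neutral_left) auto
    then have "f = sum c {- int n}" using c by (simp add: is_decomposition_def)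
    then show "f \<in> hom_forms scale gr n (- int n)" using cm by simp
  qed
qed

lemma small_forms_subset_big: "small_forms scale gr n \<subseteq> big_forms scale gr n"
  by (auto simp: small_forms_def big_forms_def)

lemma subspace_small_forms: "forms.subspace (small_forms scale gr n)"
proof (cases "n = 0")
  case True
  then show ?thesis using subspace_const_forms[OF subspace_gr] by (simp add: small_forms_def)
next
  case False
  then show ?thesis using small_forms_eq_hom_forms subspace_hom_forms by simp
qed

lemma diff_in_small_forms:
  assumes "f \<in> small_forms scale gr n"
  shows "diff scale gr br n f \<in> small_forms scale gr (n + 1)"
proof (cases "n = 0")
  case True
  then obtain g where "f = const_form g" "g \<in> gr 0" using assms by (auto simp: small_forms_def)
  then show ?thesis
    using True ad_in_hom_forms[of g 0] small_forms_eq_hom_forms[of 1] by (simp add: diff_const_form)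
next
  case False
  then have n: "n \<ge> 1" by simp
  then have f: "f \<in> hom_forms scale gr n (- int n)" using assms small_forms_eq_hom_forms by simp
  have "hom_diff n (- int n) f \<in> hom_forms scale gr (n + 1) (- int (n + 1))"
    using hom_diff_in_hom_forms[OF n f] by (simp add: minus_diff_commute)
  then show ?thesis using diff_hom_form[OF n f] small_forms_eq_hom_forms[of "n + 1"] by simp
qed

lemma cochain_complex_big_forms:
  "cochain_complex (map_scale scale) (big_forms scale gr) (diff scale gr br)"
  unfolding cochain_complex_def
  using vector_space_map_scale subspace_big_forms diff_add diff_map_scale diff_in_big_forms diff_diff
  by blast

end

theorem mainTheorem2:
  fixes scale :: "'k::field_char_0 \<Rightarrow> 'a::ring \<Rightarrow> 'a"
    and gr :: "int \<Rightarrow> 'a set"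
    and br :: "'a \<Rightarrow> 'a \<Rightarrow> 'a"
  assumes "gerstenhaber_algebra scale gr br"
  shows "(\<forall>n. diff scale gr br n ` big_forms scale gr n \<subseteq> big_forms scale gr (n + 1)) \<and>
    (\<forall>n. \<forall>f\<in>big_forms scale gr n. diff scale gr br (n + 1) (diff scale gr br n f) = 0) \<and>
    cochain_complex (map_scale scale) (big_forms scale gr) (diff scale gr br) \<and>
    (\<forall>n. diff scale gr br n ` small_forms scale gr n \<subseteq> small_forms scale gr (n + 1)) \<and>
    subcomplex (map_scale scale) (small_forms scale gr) (big_forms scale gr) (diff scale gr br)"
proof -
  interpret gerstenhaber_algebra scale gr br by (rule assms)
  show ?thesis
    unfolding subcomplex_def
    using cochain_complex_big_forms diff_in_big_forms diff_diff diff_in_small_forms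
      small_forms_subset_big subspace_small_forms
    by (auto simp: image_subset_iff)
qed

end
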